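(* Fix an integer $n\ge 2$, let $a=\exp(2\pi i/n)$, and let $D,S$ be the $n\times n$ clock and shift matrices defined in the context. Then $D,S$ are generators for the Lie algebra $\mathfrak{sl}(n)$ over $\mathbb{C}$: with $T_m^k$ as in the context, $$\mathfrak{sl}(n)=\operatorname{Span}\bigl(D,\,S,\,T_m^k \;\big|\; 1\le k,m\le n,\ \text{and } k\ne n \text{ for } m=1,n,\ \text{and } k\neq 1 \text{ for } m=n\bigr).$$ A defining set of relations for the generators $D,S$ is obtained in the following way. The relations (1) $(\operatorname{ad}D)^n(S)=(1-a)^nS$, (2) $(\operatorname{ad}D)^n\bigl((\operatorname{ad}S)^{m-1}(\operatorname{ad}D(S))\bigr)=(1-a)^m(1-a^m)^n(-1)^{m+1}\,(\operatorname{ad}S)^{m-1}(\operatorname{ad}D(S))$ for $1\le m\le n-1$, (3) $\operatorname{ad}S(T_{n-1}^1)=(1-a)^n(-1)^{n}D$, (4) $\operatorname{ad}S(T_{n-1}^n)=0$, (5) $\operatorname{ad}S(T_n^k)=(-1)^n(1-a^k)^2(1-a^{n-1})^{k-1}(1-a)^{n-k}\,T_1^k$ for $2\le k\le n-1$, (6) $\operatorname{ad}D(T_n^k)=0$ for $2\le k\le n-1$ prohibit generation of elements of order higher than $n$ in both $D$ and $S$. Besides them, for each $T_m^k$ with $2\le m\le n-1$, except for $T_2^2$, the following $m-1$ relations have to hold: (7) $$(\operatorname{ad}S)^{s_1}\Bigl((\operatorname{ad}D)^{k-1}\bigl((\operatorname{ad}S)^{s_2}(T_1^1)\bigr)\Bigr)=\left(\frac{1-a^k}{1-a}\right)^{s_1}\left(\frac{1-a^{s_1}}{1-a^{m-1}}\right)^{k-1}T_m^k,$$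 where $s_1+s_2=m-1$ and $s_1=1,2,\dots,m-1$.
   Context: $D=\operatorname{diag}(1,a,a^2,\dots,a^{n-1})$, and $S$ is the $n\times n$ cyclic shift matrix with entries $S_{i,i+1}=1$ for $1\le i\le n-1$, $S_{n,1}=1$, and all other entries $0$. Write $\operatorname{ad}X(Y)=[X,Y]=XY-YX$. Set $$T_m^k=(\operatorname{ad}D)^{k-1}\bigl((\operatorname{ad}S)^{m-1}(\operatorname{ad}D(S))\bigr)\quad(1\le m\le n-1,\ 1\le k\le n),\qquad T_n^k=\operatorname{ad}S(T_{n-1}^k)\quad(1\le k\le n).$$ A defining set of relations is one presenting $\mathfrak{sl}(n)$ as the quotient of the free Lie algebra on the two generators $D,S$ by these relations, each $T_m^k$ being read as the indicated iterated bracket of $D$ and $S$.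
   Formalization: Four coefficients are corrected: in (2) to (1-a^m)^n; in (3) the sign to (-1)^{n-1}; in (5) the exponent n-k to n-k-1; in (7) the second quotient to (1-a^{m-s_1})/(1-a^m). As printed, (1) and (2) with m=1 force [D,S]=0, so the relations present the zero algebra. *)

theory Defs
  imports Complex_Main "HOL.Hull" "HOL-Algebra.AbelCoset" "Jordan_Normal_Form.VS_Connect"
begin

section \<open>Lie algebras\<close>

text \<open>Lie algebras extend the module records of HOL-Algebra (whose ring fields \<open>mult\<close> and
  \<open>one\<close> carry no meaning for modules) by a bracket. Over a field of type \<open>'k\<close> the scalar ring is
  \<open>class_ring\<close>.\<close>

record ('k, 'a) lie_alg = "('k, 'a) module" +
  bracket :: "'a \<Rightarrow> 'a \<Rightarrow> 'a"

abbreviation ad :: "('k, 'a, 'z) lie_alg_scheme \<Rightarrow> 'a \<Rightarrow> 'a \<Rightarrow> 'a" where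
  "ad L x \<equiv> bracket L x"

locale lie_algebra = vectorspace K L
  for K :: "('k, 'r) ring_scheme" and L :: "('k, 'a, 'z) lie_alg_scheme" (structure) +
  assumes bracket_closed:
      "\<lbrakk>x \<in> carrier L; y \<in> carrier L\<rbrakk> \<Longrightarrow> bracket L x y \<in> carrier L"
    and bracket_add_left:
      "\<lbrakk>x \<in> carrier L; y \<in> carrier L; z \<in> carrier L\<rbrakk>
        \<Longrightarrow> bracket L (x \<oplus> y) z = bracket L x z \<oplus> bracket L y z"
    and bracket_add_right:
      "\<lbrakk>x \<in> carrier L; y \<in> carrier L; z \<in> carrier L\<rbrakk>
        \<Longrightarrow> bracket L x (y \<oplus> z) = bracket L x y \<oplus> bracket L x z"
    and bracket_smult_left:
      "\<lbrakk>c \<in> carrier K; x \<in> carrier L; y \<in> carrier L\<rbrakk>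
        \<Longrightarrow> bracket L (c \<odot> x) y = c \<odot> bracket L x y"
    and bracket_smult_right:
      "\<lbrakk>c \<in> carrier K; x \<in> carrier L; y \<in> carrier L\<rbrakk>
        \<Longrightarrow> bracket L x (c \<odot> y) = c \<odot> bracket L x y"
    and bracket_alternating:
      "x \<in> carrier L \<Longrightarrow> bracket L x x = \<zero>"
    and jacobi:
      "\<lbrakk>x \<in> carrier L; y \<in> carrier L; z \<in> carrier L\<rbrakk>
        \<Longrightarrow> bracket L x (bracket L y z) \<oplus> bracket L y (bracket L z x)
              \<oplus> bracket L z (bracket L x y) = \<zero>"

definition lie_subalgebra ::
    "('k :: field, 'a, 'z) lie_alg_scheme \<Rightarrow> 'a set \<Rightarrow> bool" where
  "lie_subalgebra L H \<longleftrightarrow>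
     LinearCombinations.submodule class_ring H L \<and> (\<forall>x\<in>H. \<forall>y\<in>H. bracket L x y \<in> H)"

definition lie_ideal ::
    "('k :: field, 'a, 'z) lie_alg_scheme \<Rightarrow> 'a set \<Rightarrow> bool" where
  "lie_ideal L I \<longleftrightarrow>
     LinearCombinations.submodule class_ring I L
       \<and> (\<forall>x\<in>carrier L. \<forall>y\<in>I. bracket L x y \<in> I \<and> bracket L y x \<in> I)"

definition lie_quot ::
    "('k, 'a, 'z) lie_alg_scheme \<Rightarrow> 'a set \<Rightarrow> ('k, 'a set) lie_alg" where
  "lie_quot L I =
     \<lparr>carrier = a_rcosets\<^bsub>L\<^esub> I,
      mult = undefined,
      one = undefined,
      zero = I,
      add = set_add L,
      smult = (\<lambda>c X. \<Union>x\<in>X. I +>\<^bsub>L\<^esub> (c \<odot>\<^bsub>L\<^esub> x)),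
      bracket = (\<lambda>X Y. \<Union>x\<in>X. \<Union>y\<in>Y. I +>\<^bsub>L\<^esub> bracket L x y)\<rparr>"

definition lie_hom ::
    "('k :: field, 'a, 'y) lie_alg_scheme \<Rightarrow> ('k, 'b, 'z) lie_alg_scheme \<Rightarrow> ('a \<Rightarrow> 'b) set" where
  "lie_hom L M =
     {f \<in> LinearCombinations.module_hom class_ring L M.
        \<forall>x\<in>carrier L. \<forall>y\<in>carrier L. f (bracket L x y) = bracket M (f x) (f y)}"

definition lie_iso ::
    "('k :: field, 'a, 'y) lie_alg_scheme \<Rightarrow> ('k, 'b, 'z) lie_alg_scheme \<Rightarrow> ('a \<Rightarrow> 'b) set" where
  "lie_iso L M = {f \<in> lie_hom L M. bij_betw f (carrier L) (carrier M)}"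

section \<open>Free Lie algebras and presentations\<close>

text \<open>The free Lie algebra over \<open>'k\<close> on the generators \<open>'g\<close> consists of the formal Lie expressions
  modulo the congruence generated by the axioms of a Lie algebra over \<open>'k\<close>.\<close>

datatype ('k, 'g) lie_term =
    LGen 'g
  | LZero
  | LAdd "('k, 'g) lie_term" "('k, 'g) lie_term"
  | LSmult 'k "('k, 'g) lie_term"
  | LBracket "('k, 'g) lie_term" "('k, 'g) lie_term"

inductive lie_eq :: "('k :: field, 'g) lie_term \<Rightarrow> ('k, 'g) lie_term \<Rightarrow> bool" where
  refl: "lie_eq x x"
| sym: "lie_eq x y \<Longrightarrow> lie_eq y x"
| trans: "lie_eq x y \<Longrightarrow> lie_eq y z \<Longrightarrow> lie_eq x z"
| add_cong: "lie_eq x x' \<Longrightarrow> lie_eq y y' \<Longrightarrow> lie_eq (LAdd x y) (LAdd x' y')"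
| smult_cong: "lie_eq x x' \<Longrightarrow> lie_eq (LSmult c x) (LSmult c x')"
| bracket_cong: "lie_eq x x' \<Longrightarrow> lie_eq y y' \<Longrightarrow> lie_eq (LBracket x y) (LBracket x' y')"
| add_assoc: "lie_eq (LAdd (LAdd x y) z) (LAdd x (LAdd y z))"
| add_comm: "lie_eq (LAdd x y) (LAdd y x)"
| add_zero: "lie_eq (LAdd LZero x) x"
| add_inverse: "lie_eq (LAdd (LSmult (- 1) x) x) LZero"
| smult_add_left: "lie_eq (LSmult (c + d) x) (LAdd (LSmult c x) (LSmult d x))"
| smult_add_right: "lie_eq (LSmult c (LAdd x y)) (LAdd (LSmult c x) (LSmult c y))"
| smult_assoc: "lie_eq (LSmult (c * d) x) (LSmult c (LSmult d x))"
| smult_one: "lie_eq (LSmult 1 x) x"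
| bracket_add_left: "lie_eq (LBracket (LAdd x y) z) (LAdd (LBracket x z) (LBracket y z))"
| bracket_add_right: "lie_eq (LBracket x (LAdd y z)) (LAdd (LBracket x y) (LBracket x z))"
| bracket_smult_left: "lie_eq (LBracket (LSmult c x) y) (LSmult c (LBracket x y))"
| bracket_smult_right: "lie_eq (LBracket x (LSmult c y)) (LSmult c (LBracket x y))"
| bracket_alternating: "lie_eq (LBracket x x) LZero"
| jacobi: "lie_eq (LAdd (LAdd (LBracket x (LBracket y z)) (LBracket y (LBracket z x)))
                    (LBracket z (LBracket x y))) LZero"

quotient_type (overloaded) ('k, 'g) free_lie = "('k :: field, 'g) lie_term" / lie_eq
  by (rule equivpI) (auto simp: reflp_def symp_def transp_def intro: lie_eq.intros)

lift_definition free_gen :: "'g \<Rightarrow> ('k :: field, 'g) free_lie" is LGen .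

lift_definition free_zero :: "('k :: field, 'g) free_lie" is LZero .

lift_definition free_add ::
    "('k :: field, 'g) free_lie \<Rightarrow> ('k, 'g) free_lie \<Rightarrow> ('k, 'g) free_lie" is LAdd
  by (rule lie_eq.add_cong)

lift_definition free_smult :: "'k :: field \<Rightarrow> ('k, 'g) free_lie \<Rightarrow> ('k, 'g) free_lie" is LSmult
  by (rule lie_eq.smult_cong)

lift_definition free_bracket ::
    "('k :: field, 'g) free_lie \<Rightarrow> ('k, 'g) free_lie \<Rightarrow> ('k, 'g) free_lie" is LBracket
  by (rule lie_eq.bracket_cong)

definition free_lie_alg :: "('k :: field, ('k, 'g) free_lie) lie_alg" where
  "free_lie_alg =
     \<lparr>carrier = UNIV,
      mult = undefined,
      one = undefined,
      zero = free_zero,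
      add = free_add,
      smult = free_smult,
      bracket = free_bracket\<rparr>"

lemma free_lie_alg_simps [simp]:
  "carrier free_lie_alg = UNIV" "\<zero>\<^bsub>free_lie_alg\<^esub> = free_zero"
  "add free_lie_alg = free_add" "smult free_lie_alg = free_smult"
  "bracket free_lie_alg = free_bracket"
  by (simp_all add: free_lie_alg_def)

lemma lie_algebra_free_lie_alg:
  "lie_algebra class_ring (free_lie_alg :: ('k :: field, ('k, 'g) free_lie) lie_alg)"
proof -
  let ?F = "free_lie_alg :: ('k, ('k, 'g) free_lie) lie_alg"
  have ag: "abelian_group ?F"
  proof (rule abelian_groupI)
    fix x y z :: "('k, 'g) free_lie"
    show "x \<oplus>\<^bsub>?F\<^esub> y \<oplus>\<^bsub>?F\<^esub> z = x \<oplus>\<^bsub>?F\<^esub> (y \<oplus>\<^bsub>?F\<^esub> z)"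
      by simp (transfer, rule lie_eq.add_assoc)
    show "x \<oplus>\<^bsub>?F\<^esub> y = y \<oplus>\<^bsub>?F\<^esub> x"
      by simp (transfer, rule lie_eq.add_comm)
    show "\<zero>\<^bsub>?F\<^esub> \<oplus>\<^bsub>?F\<^esub> x = x"
      by simp (transfer, rule lie_eq.add_zero)
    have "free_add (free_smult (- 1) x) x = free_zero"
      by (transfer, rule lie_eq.add_inverse)
    then show "\<exists>y\<in>carrier ?F. y \<oplus>\<^bsub>?F\<^esub> x = \<zero>\<^bsub>?F\<^esub>" by auto
  qed auto
  have "module class_ring ?F"
  proof (rule moduleI[OF class_cring.is_cring ag])
    fix c d :: 'k and x y :: "('k, 'g) free_lie"
    show "(c \<oplus>\<^bsub>class_ring\<^esub> d) \<odot>\<^bsub>?F\<^esub> x = c \<odot>\<^bsub>?F\<^esub> x \<oplus>\<^bsub>?F\<^esub> d \<odot>\<^bsub>?F\<^esub> x"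
      by simp (transfer, rule lie_eq.smult_add_left)
    show "c \<odot>\<^bsub>?F\<^esub> (x \<oplus>\<^bsub>?F\<^esub> y) = c \<odot>\<^bsub>?F\<^esub> x \<oplus>\<^bsub>?F\<^esub> c \<odot>\<^bsub>?F\<^esub> y"
      by simp (transfer, rule lie_eq.smult_add_right)
    show "(c \<otimes>\<^bsub>class_ring\<^esub> d) \<odot>\<^bsub>?F\<^esub> x = c \<odot>\<^bsub>?F\<^esub> (d \<odot>\<^bsub>?F\<^esub> x)"
      by simp (transfer, rule lie_eq.smult_assoc)
    show "\<one>\<^bsub>class_ring\<^esub> \<odot>\<^bsub>?F\<^esub> x = x"
      by simp (transfer, rule lie_eq.smult_one)
  qed auto
  then have "vectorspace class_ring ?F"
    by (simp add: vectorspace_def class_field.field_axioms)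
  moreover have "lie_algebra_axioms class_ring ?F"
    by (rule lie_algebra_axioms.intro; simp; transfer; rule lie_eq.intros)
  ultimately show ?thesis by (rule lie_algebra.intro)
qed

text \<open>The universal property characterises the free Lie algebra.\<close>

primrec eval_lie_term ::
    "('k, 'a, 'z) lie_alg_scheme \<Rightarrow> ('g \<Rightarrow> 'a) \<Rightarrow> ('k, 'g) lie_term \<Rightarrow> 'a" where
  "eval_lie_term L g (LGen x) = g x"
| "eval_lie_term L g LZero = \<zero>\<^bsub>L\<^esub>"
| "eval_lie_term L g (LAdd s t) = eval_lie_term L g s \<oplus>\<^bsub>L\<^esub> eval_lie_term L g t"
| "eval_lie_term L g (LSmult c t) = c \<odot>\<^bsub>L\<^esub> eval_lie_term L g t"
| "eval_lie_term L g (LBracket s t) = bracket L (eval_lie_term L g s) (eval_lie_term L g t)"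

theorem free_lie_alg_universal:
  fixes L :: "('k :: field, 'a, 'z) lie_alg_scheme" and g :: "'g \<Rightarrow> 'a"
  assumes "lie_algebra class_ring L" and g: "\<And>x. g x \<in> carrier L"
  shows "\<exists>!f. f \<in> lie_hom free_lie_alg L \<and> (\<forall>x. f (free_gen x) = g x)"
proof -
  interpret lie_algebra class_ring L by fact
  let ?e = "eval_lie_term L g"
  have e_closed: "?e t \<in> carrier L" for t
    by (induction t) (auto simp: g bracket_closed)
  note unit_law = smult_one
  have e_eq: "?e s = ?e t" if "lie_eq s t" for s t
    using that
  proof (induction rule: lie_eq.induct)
    case (add_inverse x)
    have "(- 1 :: 'k) \<odot>\<^bsub>L\<^esub> ?e x \<oplus>\<^bsub>L\<^esub> 1 \<odot>\<^bsub>L\<^esub> ?e x = ((- 1) + 1) \<odot>\<^bsub>L\<^esub> ?e x"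
      using smult_l_distr[of "- 1" 1 "?e x"] e_closed by simp
    then show ?case using e_closed smult_one[of "?e x"] lmult_0[of "?e x"] by simp
  next
    case (add_assoc x y z) then show ?case using e_closed by (simp add: M.a_assoc)
  next
    case (add_comm x y) then show ?case using e_closed by (simp add: M.a_comm)
  next
    case (smult_add_left c d x)
    then show ?case using e_closed smult_l_distr[of c d "?e x"] by simp
  next
    case (smult_add_right c x y)
    then show ?case using e_closed smult_r_distr[of c "?e x" "?e y"] by simp
  next
    case (smult_assoc c d x)
    then show ?case using e_closed smult_assoc1[of c d "?e x"] by simp
  next
    case (smult_one x)
    then show ?case using e_closed unit_law[of "?e x"] by simp
  qed (simp_all add: e_closed bracket_add_left bracket_add_right bracket_smult_left
        bracket_smult_right bracket_alternating jacobi)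
  define f where "f = (\<lambda>x. ?e (rep_free_lie x))"
  have f_abs: "f (abs_free_lie t) = ?e t" for t
    unfolding f_def by (rule e_eq) (rule Quotient3_rep_abs[OF Quotient3_free_lie lie_eq.refl])
  have abs_ex: "\<exists>t. x = abs_free_lie t" for x :: "('k, 'g) free_lie"
    by (metis Quotient3_abs_rep[OF Quotient3_free_lie])
  have "f \<in> lie_hom free_lie_alg L \<and> (\<forall>x. f (free_gen x) = g x)"
  proof (intro conjI allI)
    have "f (free_add x y) = f x \<oplus>\<^bsub>L\<^esub> f y" "f (free_smult c x) = c \<odot>\<^bsub>L\<^esub> f x"
      "f (free_bracket x y) = bracket L (f x) (f y)" "f x \<in> carrier L" for c x y
      using abs_ex[of x] abs_ex[of y]
      by (auto simp: f_abs e_closed free_add.abs_eq free_smult.abs_eq free_bracket.abs_eq)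
    then show "f \<in> lie_hom free_lie_alg L" by (auto simp: lie_hom_def LinearCombinations.module_hom_def)
    show "f (free_gen x) = g x" for x by (simp add: f_abs free_gen.abs_eq)
  qed
  moreover have "f1 = f2"
    if 1: "f1 \<in> lie_hom free_lie_alg L" "\<forall>x. f1 (free_gen x) = g x"
    and 2: "f2 \<in> lie_hom free_lie_alg L" "\<forall>x. f2 (free_gen x) = g x" for f1 f2
  proof
    have F: "mod_hom class_ring free_lie_alg L h" if "h \<in> lie_hom free_lie_alg L"
      for h :: "('k, 'g) free_lie \<Rightarrow> 'a"
      using that lie_algebra_free_lie_alg module_axioms
      by (auto simp: mod_hom_def mod_hom_axioms_def lie_hom_def lie_algebra_def vectorspace_def)
    have z: "h free_zero = \<zero>\<^bsub>L\<^esub>" if "h \<in> lie_hom free_lie_alg L"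
      for h :: "('k, 'g) free_lie \<Rightarrow> 'a"
      using mod_hom.f0_is_0[OF F[OF that]] by simp
    have "f1 (abs_free_lie t) = f2 (abs_free_lie t)" for t
      using 1 2 z[OF 1(1)] z[OF 2(1)]
      by (induction t)
        (simp_all add: lie_hom_def LinearCombinations.module_hom_def free_gen.abs_eq[symmetric]
          free_zero.abs_eq[symmetric] free_add.abs_eq[symmetric] free_smult.abs_eq[symmetric]
          free_bracket.abs_eq[symmetric])
    then show "f1 x = f2 x" for x using abs_ex[of x] by auto
  qed
  ultimately show ?thesis by blast
qed

text \<open>\<open>lie_presentation L g R\<close>: the Lie algebra \<open>L\<close>, with generators \<open>g x\<close>, is presented by the
  relations \<open>u = v\<close> for \<open>(u, v) \<in> R\<close>.\<close>

definition lie_presentation ::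
    "('k :: field, 'a, 'z) lie_alg_scheme \<Rightarrow> ('g \<Rightarrow> 'a)
      \<Rightarrow> (('k, 'g) free_lie \<times> ('k, 'g) free_lie) set \<Rightarrow> bool" where
  "lie_presentation L g R \<longleftrightarrow>
     (let F = free_lie_alg; I = lie_ideal F hull {u \<ominus>\<^bsub>F\<^esub> v | u v. (u, v) \<in> R}
      in \<exists>f \<in> lie_iso (lie_quot F I) L. \<forall>x. f (I +>\<^bsub>F\<^esub> free_gen x) = g x)"

section \<open>The algebra sl(n), clock and shift matrices\<close>

definition sl :: "nat \<Rightarrow> (complex, complex mat) lie_alg" where
  "sl n =
     \<lparr>carrier = {A \<in> carrier_mat n n. (\<Sum>i<n. A $$ (i, i)) = 0},
      mult = undefined,
      one = undefined,
      zero = 0\<^sub>m n n,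
      add = (+),
      smult = (\<cdot>\<^sub>m),
      bracket = (\<lambda>A B. A * B - B * A)\<rparr>"

lemma sl_simps [simp]:
  "carrier (sl n) = {A \<in> carrier_mat n n. (\<Sum>i<n. A $$ (i, i)) = 0}"
  "\<zero>\<^bsub>sl n\<^esub> = 0\<^sub>m n n" "add (sl n) = (+)" "smult (sl n) = (\<cdot>\<^sub>m)"
  "bracket (sl n) = (\<lambda>A B. A * B - B * A)"
  by (simp_all add: sl_def)

lemma trace_mult_comm:
  fixes A B :: "complex mat"
  assumes "A \<in> carrier_mat n n" "B \<in> carrier_mat n n"
  shows "(\<Sum>i<n. (A * B) $$ (i, i)) = (\<Sum>i<n. (B * A) $$ (i, i))"
proof -
  have "(\<Sum>i<n. (A * B) $$ (i, i)) = (\<Sum>i<n. \<Sum>j<n. A $$ (i, j) * B $$ (j, i))"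
    using assms by (auto simp: scalar_prod_def atLeast0LessThan intro!: sum.cong)
  also have "\<dots> = (\<Sum>j<n. \<Sum>i<n. A $$ (i, j) * B $$ (j, i))" by (rule sum.swap)
  also have "\<dots> = (\<Sum>i<n. (B * A) $$ (i, i))"
    using assms by (auto simp: scalar_prod_def atLeast0LessThan mult.commute intro!: sum.cong)
  finally show ?thesis .
qed

lemma lie_algebra_sl: "lie_algebra class_ring (sl n)"
proof -
  have ag: "abelian_group (sl n)"
  proof (rule abelian_groupI)
    fix A assume A: "A \<in> carrier (sl n)"
    then have "- A \<in> carrier (sl n)" by (auto simp: sum_negf)
    moreover have "- A \<oplus>\<^bsub>sl n\<^esub> A = \<zero>\<^bsub>sl n\<^esub>" using A by auto
    ultimately show "\<exists>B\<in>carrier (sl n). B \<oplus>\<^bsub>sl n\<^esub> A = \<zero>\<^bsub>sl n\<^esub>" by blast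
  qed (auto simp: sum.distrib assoc_add_mat[of _ n n] comm_add_mat[of _ n n])
  have "module class_ring (sl n)"
    by (rule moduleI[OF class_cring.is_cring ag])
      (auto simp: sum_distrib_left[symmetric] algebra_simps intro!: eq_matI)
  then have "vectorspace class_ring (sl n)"
    by (simp add: vectorspace_def class_field.field_axioms)
  moreover have "lie_algebra_axioms class_ring (sl n)"
  proof (rule lie_algebra_axioms.intro)
    fix A B assume "A \<in> carrier (sl n)" "B \<in> carrier (sl n)"
    then have AB: "A \<in> carrier_mat n n" "B \<in> carrier_mat n n" by auto
    show "bracket (sl n) A B \<in> carrier (sl n)"
      using AB trace_mult_comm[OF AB] by (auto simp: sum_subtractf simp del: index_mult_mat(1))
    show "bracket (sl n) A A = \<zero>\<^bsub>sl n\<^esub>" using AB by auto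
    fix c :: complex
    show "bracket (sl n) (c \<odot>\<^bsub>sl n\<^esub> A) B = c \<odot>\<^bsub>sl n\<^esub> bracket (sl n) A B"
      "bracket (sl n) A (c \<odot>\<^bsub>sl n\<^esub> B) = c \<odot>\<^bsub>sl n\<^esub> bracket (sl n) A B"
      using AB by (auto simp: mult_smult_distrib[of _ n n] mult_smult_assoc_mat[of _ n n]
          right_diff_distrib simp del: index_mult_mat(1) intro!: eq_matI)
  next
    fix A B C assume "A \<in> carrier (sl n)" "B \<in> carrier (sl n)" "C \<in> carrier (sl n)"
    then have ABC: "A \<in> carrier_mat n n" "B \<in> carrier_mat n n" "C \<in> carrier_mat n n" by auto
    note ring = add_mult_distrib_mat[of _ n n _ _ n] mult_add_distrib_mat[of _ n n _ n]
      minus_mult_distrib_mat[of _ n n _ _ n] mult_minus_distrib_mat[of _ n n _ n]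
      assoc_mult_mat[of _ n n _ n _ n]
    show "bracket (sl n) (A \<oplus>\<^bsub>sl n\<^esub> B) C = bracket (sl n) A C \<oplus>\<^bsub>sl n\<^esub> bracket (sl n) B C"
      "bracket (sl n) A (B \<oplus>\<^bsub>sl n\<^esub> C) = bracket (sl n) A B \<oplus>\<^bsub>sl n\<^esub> bracket (sl n) A C"
      "bracket (sl n) A (bracket (sl n) B C) \<oplus>\<^bsub>sl n\<^esub> bracket (sl n) B (bracket (sl n) C A)
         \<oplus>\<^bsub>sl n\<^esub> bracket (sl n) C (bracket (sl n) A B) = \<zero>\<^bsub>sl n\<^esub>"
      using ABC by (auto simp: ring simp del: index_mult_mat(1) intro!: eq_matI)
  qed
  ultimately show ?thesis by (rule lie_algebra.intro)
qed

text \<open>Matrix indices run from \<open>0\<close> to \<open>n - 1\<close>.\<close>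

definition clock :: "nat \<Rightarrow> complex \<Rightarrow> complex mat" where
  "clock n a = mat n n (\<lambda>(i, j). if i = j then a ^ i else 0)"

definition shift :: "nat \<Rightarrow> complex mat" where
  "shift n = mat n n (\<lambda>(i, j). if j = i + 1 \<or> (i = n - 1 \<and> j = 0) then 1 else 0)"

text \<open>\<open>T L n D S m k\<close> is the element $T_m^k$ formed from two elements \<open>D\<close>, \<open>S\<close> of any Lie
  algebra \<open>L\<close>; it is meaningful for $1 \le m, k \le n$.\<close>

definition T ::
    "('k, 'a, 'z) lie_alg_scheme \<Rightarrow> nat \<Rightarrow> 'a \<Rightarrow> 'a \<Rightarrow> nat \<Rightarrow> nat \<Rightarrow> 'a" where
  "T L n D S m k =
     (let T' = (\<lambda>m. (ad L D ^^ (k - 1)) ((ad L S ^^ (m - 1)) (ad L D S)))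
      in if m = n then ad L S (T' (n - 1)) else T' m)"

text \<open>With $SD = a\,DS$ one has $[D, D^k S^m] = (1 - a^m) D^{k+1} S^m$ and
  $[S, D^k S^m] = -(1 - a^k) D^k S^{m+1}$, hence
  $T_m^k = (-1)^{m-1} (1-a)^m (1-a^m)^{k-1} D^k S^m$ for $m < n$; the scalars below are the ones
  this forces. Some scalars printed in the literature are miscalculated: a factor
  $(-1)^{m+1}(1-a)^m$ on the right of \<open>rels2\<close>, the sign $(-1)^n$ in \<open>rels3\<close>, the exponent $n-k$
  in \<open>rels5\<close> and the quotient $(1-a^{s_1})/(1-a^{m-1})$ in \<open>rels7\<close>. In particular the printed
  form of \<open>rels2\<close> for $m = 1$, together with \<open>rels1\<close>, gives $[D,S] = 0$.\<close>

context
  fixes L :: "(complex, 'a, 'z) lie_alg_scheme" (structure)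
    and n :: nat and a :: complex and D S :: 'a
begin

definition rels1 :: "('a \<times> 'a) set" where
  "rels1 = {((ad L D ^^ n) S, (1 - a) ^ n \<odot> S)}"

definition rels2 :: "('a \<times> 'a) set" where
  "rels2 =
     {((ad L D ^^ n) ((ad L S ^^ (m - 1)) (ad L D S)),
       (1 - a ^ m) ^ n \<odot> (ad L S ^^ (m - 1)) (ad L D S)) | m.
      1 \<le> m \<and> m \<le> n - 1}"

definition rels3 :: "('a \<times> 'a) set" where
  "rels3 = {(ad L S (T L n D S (n - 1) 1), ((1 - a) ^ n * (- 1) ^ (n - 1)) \<odot> D)}"

definition rels4 :: "('a \<times> 'a) set" where
  "rels4 = {(ad L S (T L n D S (n - 1) n), \<zero>)}"

definition rels5 :: "('a \<times> 'a) set" where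
  "rels5 =
     {(ad L S (T L n D S n k),
       ((- 1) ^ n * (1 - a ^ k)\<^sup>2 * (1 - a ^ (n - 1)) ^ (k - 1) * (1 - a) ^ (n - k - 1))
         \<odot> T L n D S 1 k) | k.
      2 \<le> k \<and> k \<le> n - 1}"

definition rels6 :: "('a \<times> 'a) set" where
  "rels6 = {(ad L D (T L n D S n k), \<zero>) | k. 2 \<le> k \<and> k \<le> n - 1}"

definition rels7 :: "('a \<times> 'a) set" where
  "rels7 =
     {((ad L S ^^ s1) ((ad L D ^^ (k - 1)) ((ad L S ^^ s2) (T L n D S 1 1))),
       (((1 - a ^ k) / (1 - a)) ^ s1 * ((1 - a ^ (m - s1)) / (1 - a ^ m)) ^ (k - 1))
         \<odot> T L n D S m k) | m k s1 s2.
      2 \<le> m \<and> m \<le> n - 1 \<and> 1 \<le> k \<and> k \<le> n \<and> (m, k) \<noteq> (2, 2)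
        \<and> 1 \<le> s1 \<and> s1 \<le> m - 1 \<and> s1 + s2 = m - 1}"

definition clock_shift_rels :: "('a \<times> 'a) set" where
  "clock_shift_rels = rels1 \<union> rels2 \<union> rels3 \<union> rels4 \<union> rels5 \<union> rels6 \<union> rels7"

end

datatype gen = GenD | GenS

end

theory Submission
  imports Defs
begin

text \<open>From \<open>S D = a D S\<close> the bracket with \<open>D\<close> or \<open>S\<close> sends \<open>D\<^sup>k S\<^sup>m\<close> to a multiple of
  \<open>D\<^sup>k\<^sup>+\<^sup>1 S\<^sup>m\<close> or \<open>D\<^sup>k S\<^sup>m\<^sup>+\<^sup>1\<close>, so \<open>T\<^sub>m\<^sup>k\<close> is a multiple of \<open>D\<^sup>k S\<^sup>m\<close>, nonzero for
  the listed indices, and discrete Fourier inversion shows that these and \<open>D\<close>, \<open>S\<close> form a basis of \<open>sl n\<close>. Conversely, in the free Lie algebra the relations imply that the span of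
  \<open>D\<close>, \<open>S\<close> and the listed \<open>T\<^sub>m\<^sup>k\<close> is stable under \<open>ad D\<close> and \<open>ad S\<close> modulo the ideal
  \<open>I\<close> they generate (only \<open>[S, T\<^sub>1\<^sup>2] = T\<^sub>2\<^sup>2\<close> comes from the Jacobi identity). Hence this span is
  everything modulo \<open>I\<close>, and since the images in \<open>sl n\<close> of its \<open>n\<^sup>2 - 1\<close> generators are linearly
  independent, the kernel of the projection to \<open>sl n\<close> is \<open>I\<close>.\<close>

section \<open>Lie ideals and presentations\<close>

lemma module_lie_algebra: "lie_algebra K L \<Longrightarrow> module K L"
  by (simp add: lie_algebra_def vectorspace_def)

section \<open>Differences in abelian groups and submodules\<close>

lemma (in abelian_group) minus_eq_zeroD:
  assumes "x \<ominus> y = \<zero>" "x \<in> carrier G" "y \<in> carrier G"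
  shows "x = y"
proof -
  have "x \<oplus> \<ominus> y = \<zero>"
    using assms(1) by (simp add: a_minus_def)
  then have "\<ominus> (\<ominus> y) = x"
    using assms by (intro minus_equality) auto
  then show ?thesis
    using assms by simp
qed

lemma (in abelian_group) minus_add_cancel:
  assumes "x \<in> carrier G" "y \<in> carrier G"
  shows "(x \<ominus> y) \<oplus> y = x"
  using assms by (simp add: a_minus_def a_assoc l_neg)

lemma (in Module.module) submodule_uminus:
  assumes "submodule R N M" "x \<in> N"
  shows "\<ominus>\<^bsub>M\<^esub> x \<in> N"
proof -
  have "(\<ominus>\<^bsub>R\<^esub> \<one>\<^bsub>R\<^esub>) \<odot>\<^bsub>M\<^esub> x \<in> N"
    using assms by (intro submodule.smult_closed) auto
  moreover have "x \<in> carrier M"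
    using assms submodule.subset by blast
  ultimately show ?thesis
    by (simp add: smult_minus_1)
qed

lemma (in Module.module) submodule_minus:
  "submodule R N M \<Longrightarrow> x \<in> N \<Longrightarrow> y \<in> N \<Longrightarrow> x \<ominus>\<^bsub>M\<^esub> y \<in> N"
  by (simp add: a_minus_def submodule.m_closed submodule_uminus)

lemma (in Module.module) submodule_minusD:
  assumes "submodule R N M" "x \<ominus>\<^bsub>M\<^esub> y \<in> N" "y \<in> N" "x \<in> carrier M"
  shows "x \<in> N"
proof -
  have "y \<in> carrier M"
    using assms submodule.subset by blast
  then show ?thesis
    using submodule.m_closed[OF assms(1,2,3)] assms(4) by (simp add: M.minus_add_cancel)
qed

lemma (in Module.module) abelian_subgroup_submodule:
  assumes "submodule R N M"
  shows "abelian_subgroup N M"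
proof (rule abelian_subgroupI3)
  show "additive_subgroup N M"
    using submodule_uminus[OF assms] submodule.subset[OF assms] submodule.m_closed[OF assms]
      submodule.zero_closed[OF assms]
    by (intro additive_subgroup.intro subgroup.intro) (auto simp: a_inv_def[symmetric])
next
  show "abelian_group M" ..
qed

text \<open>Ideals generated by a set are intersections of this kind. The family is taken nonempty
  because \<open>\<Inter>{}\<close> is the whole type, which may exceed the carrier of
  \<open>L\<close>.\<close>

lemma lie_ideal_Inter:
  assumes ne: "\<T> \<noteq> {}" and ideal: "\<And>I. I \<in> \<T> \<Longrightarrow> lie_ideal L I"
  shows "lie_ideal L (\<Inter>\<T>)"
proof -
  have sub: "submodule class_ring I L" if "I \<in> \<T>" for I
    using ideal[OF that] by (simp add: lie_ideal_def)
  have "submodule class_ring (\<Inter>\<T>) L"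
  proof (rule submodule.intro)
    obtain I where I: "I \<in> \<T>"
      using ne by blast
    then show "\<Inter>\<T> \<subseteq> carrier L"
      using submodule.subset[OF sub] by blast
    show "Module.module class_ring L"
      using submodule.module[OF sub[OF I]] .
  qed (use submodule.m_closed[OF sub] submodule.zero_closed[OF sub]
      submodule.smult_closed[OF sub] in auto)
  then show ?thesis
    using ideal by (simp add: lie_ideal_def)
qed

section \<open>Bracket identities and kernels of homomorphisms\<close>

lemma (in lie_algebra) bracket_zero:
  assumes "x \<in> carrier L"
  shows "bracket L x \<zero> = \<zero>" "bracket L \<zero> x = \<zero>"
  using bracket_smult_right[of "\<zero>\<^bsub>K\<^esub>" x "\<zero>"] bracket_smult_left[of "\<zero>\<^bsub>K\<^esub>" "\<zero>" x] assms
  by (auto simp: bracket_closed)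

lemma (in lie_algebra) bracket_antisym:
  assumes x: "x \<in> carrier L" and y: "y \<in> carrier L"
  shows "bracket L y x = \<ominus> bracket L x y"
proof -
  have "\<zero> = bracket L (x \<oplus> y) (x \<oplus> y)"
    using x y by (simp add: bracket_alternating)
  also have "\<dots> = bracket L y x \<oplus> bracket L x y"
    unfolding bracket_add_left[OF x y M.a_closed[OF x y]]
    using x y by (simp add: bracket_add_right bracket_closed bracket_alternating M.a_comm)
  finally show ?thesis
    using x y by (intro M.minus_equality[symmetric]) (auto simp: bracket_closed)
qed

lemma (in lie_algebra) bracket_uminus_left:
  assumes "x \<in> carrier L" "y \<in> carrier L"
  shows "bracket L (\<ominus> x) y = \<ominus> bracket L x y"
  using bracket_smult_left[of "\<ominus>\<^bsub>K\<^esub> \<one>\<^bsub>K\<^esub>" x y] assms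
  by (simp add: smult_minus_1 bracket_closed)

text \<open>The Jacobi identity, rearranged by antisymmetry so that it says that \<open>ad\<close>
  of a bracket is the commutator of the two maps \<open>ad\<close>.\<close>

lemma (in lie_algebra) bracket_bracket_left:
  assumes x: "x \<in> carrier L" and y: "y \<in> carrier L" and z: "z \<in> carrier L"
  shows "bracket L (bracket L x y) z
    = bracket L x (bracket L y z) \<ominus> bracket L y (bracket L x z)"
proof -
  have 1: "bracket L z (bracket L x y) = \<ominus> bracket L (bracket L x y) z"
    and "bracket L z x = \<ominus> bracket L x z"
    using x y z by (simp_all add: bracket_closed bracket_antisym[of _ z])
  then have 2: "bracket L y (bracket L z x) = \<ominus> bracket L y (bracket L x z)"
    using bracket_smult_right[of "\<ominus>\<^bsub>K\<^esub> \<one>\<^bsub>K\<^esub>" y "bracket L x z"] x y z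
    by (simp add: bracket_closed smult_minus_1)
  have "(bracket L x (bracket L y z) \<ominus> bracket L y (bracket L x z))
      \<ominus> bracket L (bracket L x y) z = \<zero>"
    using jacobi[OF x y z] unfolding 1 2 by (simp add: a_minus_def)
  then show ?thesis
    by (rule M.minus_eq_zeroD[symmetric]) (use x y z in \<open>auto simp: bracket_closed\<close>)
qed

lemma lie_ideal_kernel:
  fixes L :: "('k :: field, 'a, 'y) lie_alg_scheme" and M :: "('k, 'b, 'z) lie_alg_scheme"
  assumes L: "lie_algebra class_ring L" and M: "lie_algebra class_ring M"
    and f: "f \<in> lie_hom L M"
  shows "lie_ideal L {x \<in> carrier L. f x = \<zero>\<^bsub>M\<^esub>}"
proof -
  interpret L: lie_algebra class_ring L by fact
  interpret M: lie_algebra class_ring M by fact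
  interpret f: mod_hom class_ring L M f
    using f by unfold_locales (auto simp: lie_hom_def)
  have "f (bracket L x y) = bracket M (f x) (f y)" if "x \<in> carrier L" "y \<in> carrier L" for x y
    using f that by (simp add: lie_hom_def)
  then show ?thesis
    using f.ker_is_submodule by (auto simp: lie_ideal_def f.ker_def L.bracket_closed M.bracket_zero)
qed

section \<open>Generation of the free Lie algebra\<close>

lemma free_lie_generated:
  fixes N :: "('k :: field, 'g) free_lie set"
  assumes N: "lie_subalgebra free_lie_alg N" and gen: "\<And>g. free_gen g \<in> N"
  shows "N = UNIV"
proof -
  have sub: "submodule class_ring N (free_lie_alg :: ('k, ('k, 'g) free_lie) lie_alg)"
    using N by (simp add: lie_subalgebra_def)
  \<comment> \<open>Every element is the class of a formal term, and each term constructor preserves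
    membership in \<open>N\<close>.\<close>
  have "abs_free_lie t \<in> N" for t
  proof (induction t)
    case (LGen x)
    then show ?case using gen by (simp add: free_gen.abs_eq)
  next
    case LZero
    then show ?case using submodule.zero_closed[OF sub] by (simp add: free_zero.abs_eq)
  next
    case (LAdd s t)
    then show ?case
      using submodule.m_closed[OF sub] by (simp add: free_add.abs_eq[symmetric])
  next
    case (LSmult c t)
    then show ?case using submodule.smult_closed[OF sub, of c] by (simp add: free_smult.abs_eq[symmetric])
  next
    case (LBracket s t)
    then show ?case
      using N by (auto simp: lie_subalgebra_def free_bracket.abs_eq[symmetric])
  qed
  then show ?thesis
    by (metis Quotient3_abs_rep[OF Quotient3_free_lie] UNIV_eq_I)
qed

text \<open>Closure under the bracket is \<open>bracket_bracket_left\<close>: if \<open>ad x\<close>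
  and \<open>ad y\<close> preserve \<open>N\<close>, then so does their commutator.\<close>

lemma lie_subalgebra_stabilizer:
  fixes L :: "('k :: field, 'a, 'z) lie_alg_scheme"
  assumes L: "lie_algebra class_ring L" and N: "submodule class_ring N L"
  shows "lie_subalgebra L {x \<in> carrier L. \<forall>y\<in>N. bracket L x y \<in> N}"
proof -
  interpret lie_algebra class_ring L by fact
  have NL: "y \<in> carrier L" if "y \<in> N" for y
    using N that submodule.subset by blast
  show ?thesis
    unfolding lie_subalgebra_def submodule_def
    using submodule_minus[OF N] submodule.m_closed[OF N] submodule.zero_closed[OF N]
      submodule.smult_closed[OF N] module_axioms
    by (auto simp: NL bracket_closed bracket_add_left bracket_smult_left bracket_zero
        bracket_bracket_left)
qed

text \<open>Generation is applied twice. The elements whose \<open>ad\<close> preserves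
  \<open>N\<close> form a subalgebra containing the generators, hence are everything; therefore
  \<open>N\<close> is itself a subalgebra containing the generators. This reduces stability to
  brackets with generators.\<close>

lemma free_lie_ad_stable:
  fixes N :: "('k :: field, 'g) free_lie set"
  assumes N: "submodule class_ring N (free_lie_alg :: ('k, ('k, 'g) free_lie) lie_alg)"
    and gen: "\<And>g. free_gen g \<in> N" "\<And>g x. x \<in> N \<Longrightarrow> free_bracket (free_gen g) x \<in> N"
  shows "N = UNIV"
proof -
  have "{x. \<forall>y\<in>N. free_bracket x y \<in> N} = UNIV"
    using free_lie_generated[of "{x. \<forall>y\<in>N. free_bracket x y \<in> N}"] gen(2)
      lie_subalgebra_stabilizer[OF lie_algebra_free_lie_alg N] by simp
  then have "lie_subalgebra free_lie_alg N"
    using N by (auto simp: lie_subalgebra_def)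
  then show ?thesis
    using free_lie_generated gen(1) by blast
qed

text \<open>The predicate passes to intersections, the empty one included: its value
  \<open>UNIV\<close> is the carrier of the free Lie algebra.\<close>

lemma lie_ideal_hull:
  fixes R :: "('k :: field, 'g) free_lie set"
  shows "lie_ideal free_lie_alg (lie_ideal free_lie_alg hull R)"
proof (rule hull_in)
  fix \<T> :: "('k, 'g) free_lie set set"
  have "module class_ring (free_lie_alg :: ('k, ('k, 'g) free_lie) lie_alg)"
    by (rule module_lie_algebra[OF lie_algebra_free_lie_alg])
  moreover from this
  have "lie_ideal (free_lie_alg :: ('k, ('k, 'g) free_lie) lie_alg) UNIV"
    by (auto simp: lie_ideal_def submodule_def)
  ultimately show "Ball \<T> (lie_ideal free_lie_alg) \<Longrightarrow> lie_ideal free_lie_alg (\<Inter>\<T>)"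
    by (cases "\<T> = {}") (auto intro: lie_ideal_Inter)
qed

text \<open>The first isomorphism theorem for \<open>\<phi>\<close>: its kernel is the ideal
  generated by the relations, so the induced map on the quotient is bijective onto
  \<open>L\<close>.\<close>

lemma lie_presentationI:
  fixes L :: "('k :: field, 'a, 'z) lie_alg_scheme"
    and R :: "(('k, 'g) free_lie \<times> ('k, 'g) free_lie) set"
  defines "I \<equiv> lie_ideal free_lie_alg hull {u \<ominus>\<^bsub>free_lie_alg\<^esub> v | u v. (u, v) \<in> R}"
  assumes L: "lie_algebra class_ring L" and \<phi>: "\<phi> \<in> lie_hom free_lie_alg L"
    and gen: "\<And>x. \<phi> (free_gen x) = g x" and onto: "range \<phi> = carrier L"
    and ker: "\<And>x. \<phi> x = \<zero>\<^bsub>L\<^esub> \<longleftrightarrow> x \<in> I"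
  shows "lie_presentation L g R"
proof -
  let ?F = "free_lie_alg :: ('k, ('k, 'g) free_lie) lie_alg"
  interpret F: lie_algebra class_ring ?F by (rule lie_algebra_free_lie_alg)
  interpret L: lie_algebra class_ring L by fact
  interpret \<phi>: mod_hom class_ring ?F L \<phi>
    using \<phi> by unfold_locales (auto simp: lie_hom_def)
  have "lie_ideal ?F I"
    unfolding I_def by (rule lie_ideal_hull)
  then have "submodule class_ring I ?F"
    by (simp add: lie_ideal_def)
  then interpret I: abelian_subgroup I ?F
    by (rule F.abelian_subgroup_submodule)
  \<comment> \<open>The induced map. By \<open>coset\<close> below, \<open>\<phi>\<close> is
    constant on each coset, so the image is a singleton and \<open>the_elem\<close> extracts its
    value.\<close>
  define h where "h = (\<lambda>X. the_elem (\<phi> ` X))"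
  have \<phi>_closed: "\<phi> x \<in> carrier L" for x
    using onto by auto
  have \<phi>_add: "\<phi> (free_add x y) = \<phi> x \<oplus>\<^bsub>L\<^esub> \<phi> y" for x y
    using \<phi>.f_add[of x y] by simp
  have \<phi>_smult: "\<phi> (free_smult c x) = c \<odot>\<^bsub>L\<^esub> \<phi> x" for c x
    using \<phi>.f_smult[of c x] by simp
  have \<phi>_bracket: "\<phi> (free_bracket x y) = bracket L (\<phi> x) (\<phi> y)" for x y
    using \<phi> by (simp add: lie_hom_def)
  have coset: "\<phi> z = \<phi> x" if "z \<in> I +>\<^bsub>?F\<^esub> x" for z x
  proof -
    from that obtain i where "i \<in> I" "z = free_add i x"
      by (auto simp: a_r_coset_def')
    then show ?thesis
      using ker[of i] by (simp add: \<phi>_add \<phi>_closed)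
  qed
  have self: "x \<in> I +>\<^bsub>?F\<^esub> x" for x
    using I.a_rcos_self[of x] by simp
  have h_coset: "h (I +>\<^bsub>?F\<^esub> x) = \<phi> x" for x
  proof -
    have "\<phi> ` (I +>\<^bsub>?F\<^esub> x) = {\<phi> x}"
      using coset self[of x] by blast
    then show ?thesis
      by (simp add: h_def)
  qed
  have eqI: "I +>\<^bsub>?F\<^esub> x = I +>\<^bsub>?F\<^esub> y" if "\<phi> x = \<phi> y" for x y
  proof -
    have "\<phi> (x \<ominus>\<^bsub>?F\<^esub> y) = \<phi> x \<ominus>\<^bsub>L\<^esub> \<phi> y"
      by (rule \<phi>.f_minus) auto
    then have "\<phi> (x \<ominus>\<^bsub>?F\<^esub> y) = \<zero>\<^bsub>L\<^esub>"
      using that \<phi>_closed[of y] by (simp add: a_minus_def L.M.r_neg)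
    then have "x \<ominus>\<^bsub>?F\<^esub> y \<in> I"
      using ker by blast
    moreover have "x = (x \<ominus>\<^bsub>?F\<^esub> y) \<oplus>\<^bsub>?F\<^esub> y"
      using F.M.minus_add_cancel[of x y] by simp
    ultimately have "x \<in> I +>\<^bsub>?F\<^esub> y"
      unfolding a_r_coset_def' by blast
    then show ?thesis
      using F.M.a_repr_independence[OF _ _ I.a_subgroup] by simp
  qed
  \<comment> \<open>The operations of \<open>lie_quot\<close> are unions over representatives. By
    \<open>eqI\<close> all cosets in such a union coincide, so the union is a single coset.\<close>
  have quot_smult: "c \<odot>\<^bsub>lie_quot ?F I\<^esub> (I +>\<^bsub>?F\<^esub> x) = I +>\<^bsub>?F\<^esub> free_smult c x" for c x
  proof -
    have "I +>\<^bsub>?F\<^esub> free_smult c z = I +>\<^bsub>?F\<^esub> free_smult c x" if "z \<in> I +>\<^bsub>?F\<^esub> x" for z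
      by (rule eqI) (simp add: \<phi>_smult coset[OF that])
    then have "(\<Union>z\<in>I +>\<^bsub>?F\<^esub> x. I +>\<^bsub>?F\<^esub> free_smult c z) = I +>\<^bsub>?F\<^esub> free_smult c x"
      using self[of x] by blast
    then show ?thesis
      by (simp add: lie_quot_def)
  qed
  have quot_bracket: "bracket (lie_quot ?F I) (I +>\<^bsub>?F\<^esub> x) (I +>\<^bsub>?F\<^esub> y)
      = I +>\<^bsub>?F\<^esub> free_bracket x y" for x y
  proof -
    have "I +>\<^bsub>?F\<^esub> free_bracket z w = I +>\<^bsub>?F\<^esub> free_bracket x y"
      if "z \<in> I +>\<^bsub>?F\<^esub> x" "w \<in> I +>\<^bsub>?F\<^esub> y" for z w
      by (rule eqI) (simp add: \<phi>_bracket coset[OF that(1)] coset[OF that(2)])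
    then have "(\<Union>z\<in>I +>\<^bsub>?F\<^esub> x. \<Union>w\<in>I +>\<^bsub>?F\<^esub> y. I +>\<^bsub>?F\<^esub> free_bracket z w)
        = I +>\<^bsub>?F\<^esub> free_bracket x y"
      using self[of x] self[of y] by blast
    then show ?thesis
      by (simp add: lie_quot_def)
  qed
  have quot_add: "(I +>\<^bsub>?F\<^esub> x) \<oplus>\<^bsub>lie_quot ?F I\<^esub> (I +>\<^bsub>?F\<^esub> y)
      = I +>\<^bsub>?F\<^esub> free_add x y" for x y
    using I.a_rcos_sum[of x y] by (simp add: lie_quot_def)
  have carrier: "carrier (lie_quot ?F I) = range (\<lambda>x. I +>\<^bsub>?F\<^esub> x)"
    by (auto simp: lie_quot_def A_RCOSETS_def')
  have "h \<in> lie_hom (lie_quot ?F I) L"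
    by (auto simp: lie_hom_def LinearCombinations.module_hom_def carrier quot_add quot_smult quot_bracket h_coset
        \<phi>_add \<phi>_smult \<phi>_bracket \<phi>_closed)
  moreover have "inj_on h (carrier (lie_quot ?F I))"
  proof (rule inj_onI)
    fix X Y assume XY: "X \<in> carrier (lie_quot ?F I)" "Y \<in> carrier (lie_quot ?F I)"
      and h: "h X = h Y"
    obtain x where x: "X = I +>\<^bsub>?F\<^esub> x"
      using XY(1) unfolding carrier by (rule imageE)
    obtain y where y: "Y = I +>\<^bsub>?F\<^esub> y"
      using XY(2) unfolding carrier by (rule imageE)
    show "X = Y"
      using h unfolding x y h_coset by (rule eqI)
  qed
  moreover have "h ` carrier (lie_quot ?F I) = carrier L"
    using onto by (simp add: carrier image_image h_coset)
  ultimately show ?thesis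
    by (auto simp: lie_presentation_def lie_iso_def bij_betw_def Let_def h_coset gen I_def[symmetric]
        intro!: bexI[of _ h])
qed

section \<open>The matrices \<open>D\<^sup>k S\<^sup>m\<close>\<close>

text \<open>These assumptions say that \<open>a\<close> has multiplicative order exactly
  \<open>n\<close>, the form in which the exponential enters the computations.\<close>

locale primitive_root =
  fixes n :: nat and a :: complex
  assumes n_ge_2: "n \<ge> 2" and power_n: "a ^ n = 1" and power_eq_1D: "a ^ k = 1 \<Longrightarrow> n dvd k"

text \<open>Powers with exponents below \<open>n\<close> are distinct roots of unity, so
  \<open>?a ^ k = 1\<close> forces the remainder of \<open>k\<close> modulo \<open>n\<close> to be
  0.\<close>

lemma primitive_root_exp:
  assumes "n \<ge> 2"
  shows "primitive_root n (exp (2 * complex_of_real pi * \<i> / of_nat n))"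
proof
  let ?a = "exp (2 * complex_of_real pi * \<i> / of_nat n)"
  have pow: "?a ^ k = cis (2 * pi * real k / real n)" for k
    by (simp add: exp_of_nat_mult[symmetric] cis_conv_exp mult_ac of_real_divide of_real_mult)
  show an: "?a ^ n = 1"
    using assms unfolding pow by simp
  fix k assume "?a ^ k = 1"
  moreover have "?a ^ k = (?a ^ n) ^ (k div n) * ?a ^ (k mod n)"
    by (metis mult_div_mod_eq power_add power_mult)
  ultimately have eq: "cis (2 * pi * real (k mod n) / real n) = cis (2 * pi * real 0 / real n)"
    unfolding an by (simp add: pow)
  have inj: "inj_on (\<lambda>k. cis (2 * pi * real k / real n)) {..<n}"
    using bij_betw_roots_unity[of n] assms by (simp add: bij_betw_def)
  have "k mod n = 0"
    by (rule inj_onD[OF inj eq]) (use assms in auto)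
  then show "n dvd k"
    by auto
qed (rule assms)

text \<open>Character orthogonality for the cyclic group of order \<open>n\<close>, the source of
  Fourier inversion.\<close>

lemma sum_powers_root_unity:
  fixes z :: complex
  assumes "z ^ n = 1"
  shows "(\<Sum>i<n. z ^ i) = (if z = 1 then of_nat n else 0)"
  using assms by (simp add: geometric_sum)

lemma sum_powers_root_unity_Suc:
  fixes z :: complex
  assumes "z ^ n = 1"
  shows "(\<Sum>k=1..n. z ^ k) = (if z = 1 then of_nat n else 0)"
proof -
  have "(\<Sum>k=1..n. z ^ k) = z * (\<Sum>i<n. z ^ i)"
    by (simp add: sum.atLeast1_atMost_eq sum_distrib_left)
  then show ?thesis
    using sum_powers_root_unity[OF assms] by simp
qed

lemma add_mod_eq_iff:
  fixes i m m' n :: nat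
  assumes "m \<in> {1..n}" "m' \<in> {1..n}"
  shows "(i + m) mod n = (i + m') mod n \<longleftrightarrow> m = m'"
proof
  assume eq: "(i + m) mod n = (i + m') mod n"
  then have "n dvd m - m'" "n dvd m' - m"
    using mod_eq_dvd_iff_nat[of "i + m'" "i + m" n] mod_eq_dvd_iff_nat[of "i + m" "i + m'" n]
    by (cases "m' \<le> m"; simp)+
  then show "m = m'"
    using assms by (auto dest!: dvd_imp_le)
qed simp

text \<open>This is \<open>D\<^sup>k S\<^sup>m\<close> in closed form: \<open>S\<^sup>m\<close>
  places the only nonzero entry of row \<open>i\<close> in column \<open>i + m\<close> modulo
  \<open>n\<close>, and \<open>D\<^sup>k\<close> scales that row by
  \<open>a ^ (i * k)\<close>.\<close>

definition clock_shift_mat :: "nat \<Rightarrow> complex \<Rightarrow> nat \<Rightarrow> nat \<Rightarrow> complex mat" where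
  "clock_shift_mat n a k m = mat n n (\<lambda>(i, j). if j = (i + m) mod n then a ^ (i * k) else 0)"

lemma clock_shift_mat_carrier [simp]:
  "clock_shift_mat n a k m \<in> carrier_mat n n"
  "dim_row (clock_shift_mat n a k m) = n" "dim_col (clock_shift_mat n a k m) = n"
  by (simp_all add: clock_shift_mat_def)

text \<open>The discrete Fourier transform of the \<open>m\<close>-th cyclic diagonal of
  \<open>A\<close>. It gives the coefficient of \<open>A\<close> at
  \<open>D\<^sup>k S\<^sup>m\<close>.\<close>

definition clock_shift_coeff :: "nat \<Rightarrow> complex \<Rightarrow> nat \<Rightarrow> nat \<Rightarrow> complex mat \<Rightarrow> complex" where
  "clock_shift_coeff n a k m A =
     (\<Sum>i<n. A $$ (i, (i + m) mod n) * inverse a ^ (i * k)) / of_nat n"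

lemma clock_shift_coeff_add:
  assumes "A \<in> carrier_mat n n" "B \<in> carrier_mat n n"
  shows "clock_shift_coeff n a k m (A + B) = clock_shift_coeff n a k m A + clock_shift_coeff n a k m B"
  using assms
  by (simp add: clock_shift_coeff_def sum.distrib add_divide_distrib algebra_simps)

lemma clock_shift_coeff_smult:
  assumes "A \<in> carrier_mat n n"
  shows "clock_shift_coeff n a k m (c \<cdot>\<^sub>m A) = c * clock_shift_coeff n a k m A"
  using assms by (simp add: clock_shift_coeff_def sum_distrib_left mult_ac)

lemma clock_eq_clock_shift_mat: "clock n a = clock_shift_mat n a 1 0"
  by (rule eq_matI) (auto simp: clock_def clock_shift_mat_def)

lemma shift_eq_clock_shift_mat: "shift n = clock_shift_mat n a 0 1"
  by (rule eq_matI) (auto simp: shift_def clock_shift_mat_def mod_Suc)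

section \<open>Products of the matrices and Fourier expansion\<close>

context primitive_root
begin

abbreviation P :: "nat \<Rightarrow> nat \<Rightarrow> complex mat" where
  "P k m \<equiv> clock_shift_mat n a k m"

abbreviation coeff :: "nat \<Rightarrow> nat \<Rightarrow> complex mat \<Rightarrow> complex" where
  "coeff k m \<equiv> clock_shift_coeff n a k m"

lemma a_nonzero: "a \<noteq> 0"
  using power_n n_ge_2 by (metis not_numeral_le_zero power_0_left zero_neq_one)

lemma power_power_n: "(a ^ k) ^ n = 1"
  by (metis mult.commute power_mult power_n power_one)

lemma a_power_mod: "a ^ (k mod n) = a ^ k"
proof -
  have "a ^ k = (a ^ n) ^ (k div n) * a ^ (k mod n)"
    by (metis mult_div_mod_eq power_add power_mult)
  then show ?thesis
    by (simp add: power_n)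
qed

text \<open>The two inequalities say that \<open>k\<close> and \<open>l\<close> differ by less than
  \<open>n\<close>, which covers the ranges \<open>{..<n}\<close> and \<open>{1..n}\<close> at
  once.\<close>

lemma a_power_inj:
  assumes "a ^ k = a ^ l" "k < l + n" "l < k + n"
  shows "k = l"
proof -
  have "k = l" if "a ^ k = a ^ l" "k \<le> l" "l < k + n" for k l
  proof -
    have "a ^ k * a ^ (l - k) = a ^ k * 1"
      using that by (metis le_add_diff_inverse mult.right_neutral power_add)
    then have "n dvd l - k"
      using a_nonzero power_eq_1D by simp
    then show "k = l"
      using that by (auto dest!: dvd_imp_le)
  qed
  then show ?thesis
    using assms by (metis nat_le_linear)
qed

lemma P_periodic [simp]: "P (k + n) m = P k m" "P k (m + n) = P k m"
proof -
  have "a ^ (i * (k + n)) = a ^ (i * k)" for i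
    by (metis a_power_mod distrib_left mod_mult_self1 mult.commute)
  then show "P (k + n) m = P k m"
    by (simp only: clock_shift_mat_def)
  show "P k (m + n) = P k m"
    by (simp add: clock_shift_mat_def flip: add.assoc)
qed

lemma P_n [simp]: "P n m = P 0 m" "P k n = P k 0"
  using P_periodic(1)[of 0] P_periodic(2)[of _ 0] by simp_all

text \<open>The scalar arises from moving \<open>S\<^sup>m\<close> past the power \<open>k'\<close>
  of \<open>D\<close> by \<open>S D = a D S\<close>. Entrywise, row \<open>i\<close> of the left
  factor has a single nonzero entry, so the sum over the inner index has one term.\<close>

lemma P_mult: "P k m * P k' m' = a ^ (m * k') \<cdot>\<^sub>m P (k + k') (m + m')"
proof (rule eq_matI)
  fix i j
  assume "i < dim_row (a ^ (m * k') \<cdot>\<^sub>m P (k + k') (m + m'))"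
    and "j < dim_col (a ^ (m * k') \<cdot>\<^sub>m P (k + k') (m + m'))"
  then have ij: "i < n" "j < n"
    by simp_all
  let ?l = "(i + m) mod n"
  have l: "?l < n"
    using n_ge_2 by simp
  have "(P k m * P k' m') $$ (i, j) = (\<Sum>l<n. if l = ?l then a ^ (i * k) * P k' m' $$ (l, j) else 0)"
  proof -
    have "P k m $$ (i, l) = (if l = ?l then a ^ (i * k) else 0)" if "l < n" for l
      using ij that by (simp add: clock_shift_mat_def)
    then show ?thesis
      using ij by (simp add: scalar_prod_def atLeast0LessThan if_distrib[of "\<lambda>x. x * _"] cong: if_cong)
  qed
  also have "\<dots> = a ^ (i * k) * P k' m' $$ (?l, j)"
    using l by simp
  also have "\<dots> = (a ^ (m * k') \<cdot>\<^sub>m P (k + k') (m + m')) $$ (i, j)"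
  proof -
    have "a ^ (?l * k') = a ^ ((i + m) * k')"
      by (simp add: power_mult a_power_mod)
    moreover have "(?l + m') mod n = (i + (m + m')) mod n"
      by (simp add: mod_add_left_eq add.assoc)
    ultimately show ?thesis
      using ij l by (auto simp: clock_shift_mat_def power_add algebra_simps)
  qed
  finally show "(P k m * P k' m') $$ (i, j) = (a ^ (m * k') \<cdot>\<^sub>m P (k + k') (m + m')) $$ (i, j)" .
qed simp_all

text \<open>For different \<open>m\<close> the supports are disjoint cyclic diagonals; for equal
  \<open>m\<close> the coefficient is a sum of powers of a root of unity.\<close>

lemma coeff_P:
  assumes "k \<in> {1..n}" "m \<in> {1..n}" "k' \<in> {1..n}" "m' \<in> {1..n}"
  shows "coeff k m (P k' m') = (if k = k' \<and> m = m' then 1 else 0)"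
proof (cases "m = m'")
  case True
  let ?z = "a ^ k' / a ^ k"
  have "coeff k m (P k' m') = (\<Sum>i<n. ?z ^ i) / of_nat n"
    unfolding clock_shift_coeff_def
    using True n_ge_2
    by (auto simp: clock_shift_mat_def power_mult_distrib power_inverse divide_inverse
        mult.commute[of _ k] mult.commute[of _ k'] power_mult intro!: sum.cong)
  moreover have "?z ^ n = 1"
    by (simp add: power_divide power_power_n)
  moreover have "?z = 1 \<longleftrightarrow> k = k'"
    using a_power_inj[of k' k] assms a_nonzero by auto
  ultimately show ?thesis
    using sum_powers_root_unity[of ?z n] True n_ge_2 by simp
next
  case False
  then have "(i + m) mod n \<noteq> (i + m') mod n" for i
    using add_mod_eq_iff[of m n m' i] assms by simp
  then show ?thesis
    using False n_ge_2 by (simp add: clock_shift_coeff_def clock_shift_mat_def)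
qed

text \<open>Fourier inversion along one cyclic diagonal: exchanging the sums over \<open>k\<close>
  and \<open>l\<close> leaves a character sum that selects \<open>l = i\<close>.\<close>

lemma mat_expansion:
  assumes A: "A \<in> carrier_mat n n" and ij: "i < n" "j < n"
  shows "A $$ (i, j) = (\<Sum>(m, k)\<in>{1..n} \<times> {1..n}. coeff k m A * P k m $$ (i, j))"
proof -
  \<comment> \<open>The index of the cyclic diagonal through \<open>(i, j)\<close>. Indices run over
    \<open>{1..n}\<close>, so the main diagonal gets \<open>n\<close> and not 0.\<close>
  define m0 where "m0 = (if j \<le> i then n + j - i else j - i)"
  have m0: "m0 \<in> {1..n}" and j: "(i + m0) mod n = j"
    using ij by (auto simp: m0_def)
  have inner: "(\<Sum>m=1..n. coeff k m A * P k m $$ (i, j)) = coeff k m0 A * a ^ (i * k)" for k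
  proof -
    have "j = (i + m) mod n \<longleftrightarrow> m = m0" if "m \<in> {1..n}" for m
      using add_mod_eq_iff[of m n m0 i] m0 that j by metis
    then have "(\<Sum>m=1..n. coeff k m A * P k m $$ (i, j))
        = (\<Sum>m=1..n. if m = m0 then coeff k m0 A * a ^ (i * k) else 0)"
      using ij by (intro sum.cong) (auto simp: clock_shift_mat_def)
    then show ?thesis
      using m0 by simp
  qed
  have z: "(\<Sum>k=1..n. (a ^ i / a ^ l) ^ k) = (if l = i then of_nat n else 0)" if "l < n" for l
  proof -
    have "(a ^ i / a ^ l) ^ n = 1"
      by (simp add: power_divide power_power_n)
    moreover have "a ^ i / a ^ l = 1 \<longleftrightarrow> l = i"
      using a_power_inj[of i l] a_nonzero ij that by auto
    ultimately show ?thesis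
      using sum_powers_root_unity_Suc by simp
  qed
  have "(\<Sum>(m, k)\<in>{1..n} \<times> {1..n}. coeff k m A * P k m $$ (i, j))
      = (\<Sum>k=1..n. \<Sum>m=1..n. coeff k m A * P k m $$ (i, j))"
    unfolding sum.cartesian_product[symmetric] by (rule sum.swap)
  also have "\<dots> = (\<Sum>k=1..n. \<Sum>l<n. A $$ (l, (l + m0) mod n) * (a ^ i / a ^ l) ^ k / of_nat n)"
    unfolding inner unfolding clock_shift_coeff_def
    by (intro sum.cong) (auto simp: sum_divide_distrib sum_distrib_left sum_distrib_right power_mult_distrib
        power_inverse divide_inverse mult_ac simp flip: power_mult)
  also have "\<dots> = (\<Sum>l<n. \<Sum>k=1..n. A $$ (l, (l + m0) mod n) * (a ^ i / a ^ l) ^ k / of_nat n)"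
    by (rule sum.swap)
  also have "\<dots> = (\<Sum>l<n. A $$ (l, (l + m0) mod n) * (\<Sum>k=1..n. (a ^ i / a ^ l) ^ k) / of_nat n)"
    by (simp add: sum_divide_distrib sum_distrib_left)
  also have "\<dots> = (\<Sum>l<n. if l = i then A $$ (l, (l + m0) mod n) else 0)"
  proof (rule sum.cong[OF HOL.refl])
    fix l assume "l \<in> {..<n}"
    then show "A $$ (l, (l + m0) mod n) * (\<Sum>k=1..n. (a ^ i / a ^ l) ^ k) / of_nat n
        = (if l = i then A $$ (l, (l + m0) mod n) else 0)"
      using n_ge_2 by (subst z) simp_all
  qed
  also have "\<dots> = A $$ (i, j)"
    using ij j by simp
  finally show ?thesis
    by simp
qed

text \<open>If \<open>n\<close> divides \<open>m\<close>, the trace is the sum of the powers of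
  \<open>a ^ k \<noteq> 1\<close> and vanishes; otherwise the diagonal itself is zero.\<close>

lemma P_sl:
  assumes "\<not> (n dvd k \<and> n dvd m)"
  shows "P k m \<in> carrier (sl n)"
proof -
  have "(\<Sum>i<n. P k m $$ (i, i)) = 0"
  proof (cases "n dvd m")
    case True
    then have "(\<Sum>i<n. P k m $$ (i, i)) = (\<Sum>i<n. (a ^ k) ^ i)"
      by (auto simp: clock_shift_mat_def mult.commute simp flip: power_mult elim!: dvdE)
    moreover have "a ^ k \<noteq> 1"
      using power_eq_1D assms True by blast
    ultimately show ?thesis
      using sum_powers_root_unity[OF power_power_n[of k]] by simp
  next
    case False
    then have "i \<noteq> (i + m) mod n" if "i < n" for i
      using that mod_eq_dvd_iff_nat[of i "i + m" n] by auto
    then show ?thesis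
      by (simp add: clock_shift_mat_def)
  qed
  then show ?thesis
    by simp
qed

text \<open>The matrix at index \<open>(n, n)\<close> is the identity, and its coefficient is the
  trace divided by \<open>n\<close>.\<close>

lemma coeff_n_n:
  assumes "A \<in> carrier (sl n)"
  shows "coeff n n A = 0"
proof -
  have "inverse a ^ (i * n) = 1" for i
    by (simp add: mult.commute[of i] power_mult power_inverse power_n)
  then show ?thesis
    using assms by (simp add: clock_shift_coeff_def)
qed

section \<open>The adjoint action and the elements \<open>T\<close> in \<open>sl n\<close>\<close>

lemma smult_smult_P: "c \<cdot>\<^sub>m (d \<cdot>\<^sub>m P k m) = (c * d) \<cdot>\<^sub>m P k m"
  by (rule eq_matI) simp_all

lemma ad_clock:
  "ad (sl n) (clock n a) (c \<cdot>\<^sub>m P k m) = (c * (1 - a ^ m)) \<cdot>\<^sub>m P (Suc k) m"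
proof -
  have "clock n a * (c \<cdot>\<^sub>m P k m) = c \<cdot>\<^sub>m P (Suc k) m"
    by (simp add: clock_eq_clock_shift_mat P_mult smult_smult_P
        mult_smult_distrib[OF clock_shift_mat_carrier(1) clock_shift_mat_carrier(1)])
  moreover have "(c \<cdot>\<^sub>m P k m) * clock n a = (c * a ^ m) \<cdot>\<^sub>m P (Suc k) m"
    by (simp add: clock_eq_clock_shift_mat P_mult smult_smult_P
        mult_smult_assoc_mat[OF clock_shift_mat_carrier(1) clock_shift_mat_carrier(1)])
  ultimately show ?thesis
    by (auto simp: algebra_simps)
qed

lemma ad_shift:
  "ad (sl n) (shift n) (c \<cdot>\<^sub>m P k m) = (c * (a ^ k - 1)) \<cdot>\<^sub>m P k (Suc m)"
proof -
  have "shift n * (c \<cdot>\<^sub>m P k m) = (c * a ^ k) \<cdot>\<^sub>m P k (Suc m)"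
    by (simp add: shift_eq_clock_shift_mat[of n a] P_mult smult_smult_P
        mult_smult_distrib[OF clock_shift_mat_carrier(1) clock_shift_mat_carrier(1)])
  moreover have "(c \<cdot>\<^sub>m P k m) * shift n = c \<cdot>\<^sub>m P k (Suc m)"
    by (simp add: shift_eq_clock_shift_mat[of n a] P_mult smult_smult_P
        mult_smult_assoc_mat[OF clock_shift_mat_carrier(1) clock_shift_mat_carrier(1)])
  ultimately show ?thesis
    by (auto simp: algebra_simps)
qed

lemma ad_clock_funpow:
  "(ad (sl n) (clock n a) ^^ j) (c \<cdot>\<^sub>m P k m) = (c * (1 - a ^ m) ^ j) \<cdot>\<^sub>m P (k + j) m"
  by (induction j) (simp_all add: ad_clock mult_ac del: sl_simps)

lemma ad_shift_funpow:
  "(ad (sl n) (shift n) ^^ j) (c \<cdot>\<^sub>m P k m) = (c * (a ^ k - 1) ^ j) \<cdot>\<^sub>m P k (m + j)"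
  by (induction j) (simp_all add: ad_shift mult_ac del: sl_simps)

lemma one_smult_P: "1 \<cdot>\<^sub>m P k m = P k m"
  by (rule eq_matI) simp_all

lemma ad_clock_shift: "ad (sl n) (clock n a) (shift n) = (1 - a) \<cdot>\<^sub>m P 1 1"
  using ad_clock[of 1 0 1] by (simp add: shift_eq_clock_shift_mat[of n a] one_smult_P del: sl_simps)

lemma T_sl:
  assumes "1 \<le> m" "m < n" "1 \<le> k"
  shows "T (sl n) n (clock n a) (shift n) m k
    = ((1 - a) * (a - 1) ^ (m - 1) * (1 - a ^ m) ^ (k - 1)) \<cdot>\<^sub>m P k m"
  using assms
  by (cases m) (simp_all add: T_def ad_clock_shift ad_shift_funpow ad_clock_funpow del: sl_simps)

text \<open>The factor \<open>a ^ k - 1\<close> comes from the last \<open>ad S\<close>, applied to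
  row \<open>n - 1\<close> of the family; the resulting power \<open>n\<close> of the shift is
  written as 0.\<close>

lemma T_sl_n:
  assumes "1 \<le> k"
  shows "T (sl n) n (clock n a) (shift n) n k
    = ((1 - a) * (a - 1) ^ (n - 2) * (1 - a ^ (n - 1)) ^ (k - 1) * (a ^ k - 1)) \<cdot>\<^sub>m P k 0"
proof -
  have "T (sl n) n (clock n a) (shift n) n k
      = ad (sl n) (shift n) (T (sl n) n (clock n a) (shift n) (n - 1) k)"
    using n_ge_2 by (auto simp: T_def simp del: sl_simps)
  then show ?thesis
    using n_ge_2 assms by (simp add: T_sl ad_shift numeral_2_eq_2 del: sl_simps)
qed

section \<open>Validity of the relations in \<open>sl n\<close>\<close>

lemma one_minus_a_power: "1 \<le> m \<Longrightarrow> m < n \<Longrightarrow> 1 - a ^ m \<noteq> 0"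
  using power_eq_1D[of m] dvd_imp_le[of n m] by auto

lemma a_minus_1_power: "(a - 1) ^ j = (- 1) ^ j * (1 - a) ^ j"
  by (simp flip: power_mult_distrib)

text \<open>The nonzero right-hand sides are multiples of the same \<open>P k m\<close> as the
  left-hand sides, so only scalars are compared. The left-hand side vanishes in \<open>rels4\<close>
  since \<open>a ^ n = 1\<close>, and in \<open>rels6\<close> since powers of \<open>D\<close>
  commute with \<open>D\<close>.\<close>

lemma clock_shift_rels_sl:
  assumes "(u, v) \<in> clock_shift_rels (sl n) n a (clock n a) (shift n)"
  shows "u = v"
proof -
  let ?D = "clock n a" and ?S = "shift n"
  have S: "?S = 1 \<cdot>\<^sub>m P 0 1" and D: "?D = 1 \<cdot>\<^sub>m P 1 0"
    by (simp_all only: one_smult_P clock_eq_clock_shift_mat shift_eq_clock_shift_mat[of n a])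
  have zero: "0 \<cdot>\<^sub>m P k m = \<zero>\<^bsub>sl n\<^esub>" for k m
    by (auto intro!: eq_matI)
  consider "(u, v) \<in> rels1 (sl n) n a ?D ?S" | "(u, v) \<in> rels2 (sl n) n a ?D ?S"
    | "(u, v) \<in> rels3 (sl n) n a ?D ?S" | "(u, v) \<in> rels4 (sl n) n ?D ?S"
    | "(u, v) \<in> rels5 (sl n) n a ?D ?S" | "(u, v) \<in> rels6 (sl n) n ?D ?S"
    | "(u, v) \<in> rels7 (sl n) n a ?D ?S"
    using assms unfolding clock_shift_rels_def by blast
  then show ?thesis
  proof cases
    case 1
    then have "u = (ad (sl n) ?D ^^ n) ?S" "v = (1 - a) ^ n \<cdot>\<^sub>m ?S"
      by (simp_all add: rels1_def)
    moreover have "(ad (sl n) ?D ^^ n) (1 \<cdot>\<^sub>m P 0 1) = (1 - a) ^ n \<cdot>\<^sub>m P 0 1"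
      unfolding ad_clock_funpow by simp
    ultimately show ?thesis
      by (simp add: S one_smult_P del: sl_simps)
  next
    case 2
    then obtain m where m: "1 \<le> m" "m \<le> n - 1"
      and u: "u = (ad (sl n) ?D ^^ n) ((ad (sl n) ?S ^^ (m - 1)) (ad (sl n) ?D ?S))"
      and v: "v = (1 - a ^ m) ^ n \<cdot>\<^sub>m (ad (sl n) ?S ^^ (m - 1)) (ad (sl n) ?D ?S)"
      by (auto simp: rels2_def)
    show ?thesis
      using m P_periodic(1)[of 1 m] unfolding u v
      by (simp add: ad_clock_shift ad_shift_funpow ad_clock_funpow smult_smult_P mult_ac
          del: sl_simps)
  next
    case 3
    then have u: "u = ad (sl n) ?S (T (sl n) n ?D ?S (n - 1) 1)"
      and v: "v = ((1 - a) ^ n * (- 1) ^ (n - 1)) \<cdot>\<^sub>m ?D"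
      by (simp_all add: rels3_def)
    have n: "n = Suc (Suc (n - 2))"
      using n_ge_2 by simp
    have "(1 - a) * (a - 1) ^ (n - 2) * (a - 1) = (1 - a) ^ n * (- 1) ^ (n - 1)"
      by (subst (2 3) n) (simp add: a_minus_1_power algebra_simps)
    moreover have "u = ((1 - a) * (a - 1) ^ (n - 2) * (a - 1)) \<cdot>\<^sub>m P 1 0"
      using n_ge_2 unfolding u by (simp add: T_sl ad_shift numeral_2_eq_2 del: sl_simps)
    ultimately show ?thesis
      unfolding v by (simp add: clock_eq_clock_shift_mat)
  next
    case 4
    then have u: "u = ad (sl n) ?S (T (sl n) n ?D ?S (n - 1) n)" and v: "v = \<zero>\<^bsub>sl n\<^esub>"
      by (simp_all add: rels4_def)
    show ?thesis
      using n_ge_2 unfolding u v by (simp add: T_sl ad_shift power_n zero del: sl_simps)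
  next
    case 5
    then obtain k where k: "2 \<le> k" "k \<le> n - 1"
      and u: "u = ad (sl n) ?S (T (sl n) n ?D ?S n k)"
      and v: "v = ((- 1) ^ n * (1 - a ^ k)\<^sup>2 * (1 - a ^ (n - 1)) ^ (k - 1) * (1 - a) ^ (n - k - 1))
         \<cdot>\<^sub>m T (sl n) n ?D ?S 1 k"
      by (auto simp: rels5_def)
    \<comment> \<open>These differences rid the exponents of truncated subtraction.\<close>
    define j l where "j = k - 2" and "l = n - k - 1"
    have jl: "k = Suc (Suc j)" "n = Suc (Suc (Suc (j + l)))" "n - k - 1 = l"
      using k by (auto simp: j_def l_def)
    have scalar: "(1 - a) * (a - 1) ^ (n - 2) * (1 - a ^ (n - 1)) ^ (k - 1) * (a ^ k - 1) * (a ^ k - 1)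
      = (- 1) ^ n * (1 - a ^ k)\<^sup>2 * (1 - a ^ (n - 1)) ^ (k - 1) * (1 - a) ^ (n - k - 1)
        * ((1 - a) * (1 - a) ^ (k - 1))"
    proof -
      have 1: "(1 - a) * (a - 1) ^ (n - 2) = (- 1) ^ n * (1 - a) ^ (n - k - 1) * ((1 - a) * (1 - a) ^ (k - 1))"
        unfolding a_minus_1_power jl(3) by (simp add: jl(1,2) power_add)
      have 2: "(a ^ k - 1) * (a ^ k - 1) = (1 - a ^ k)\<^sup>2"
        by (simp add: power2_eq_square algebra_simps)
      show ?thesis
        unfolding 1 mult.assoc 2 by (simp only: mult_ac)
    qed
    have "u = ((1 - a) * (a - 1) ^ (n - 2) * (1 - a ^ (n - 1)) ^ (k - 1) * (a ^ k - 1) * (a ^ k - 1))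
        \<cdot>\<^sub>m P k 1"
      using k unfolding u by (simp add: T_sl_n ad_shift del: sl_simps)
    moreover have "T (sl n) n ?D ?S 1 k = ((1 - a) * (1 - a) ^ (k - 1)) \<cdot>\<^sub>m P k 1"
      using n_ge_2 k by (simp add: T_sl del: sl_simps)
    ultimately show ?thesis
      unfolding v scalar by (simp only: smult_smult_P)
  next
    case 6
    then obtain k where k: "2 \<le> k" "k \<le> n - 1"
      and u: "u = ad (sl n) ?D (T (sl n) n ?D ?S n k)" and v: "v = \<zero>\<^bsub>sl n\<^esub>"
      by (auto simp: rels6_def)
    show ?thesis
      using k unfolding u v by (simp add: T_sl_n ad_clock zero del: sl_simps)
  next
    case 7
    then obtain m k s1 s2 where m: "2 \<le> m" "m \<le> n - 1" and k: "1 \<le> k" "k \<le> n"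
      and s: "1 \<le> s1" "s1 \<le> m - 1" "s1 + s2 = m - 1"
      and u: "u = (ad (sl n) ?S ^^ s1) ((ad (sl n) ?D ^^ (k - 1))
          ((ad (sl n) ?S ^^ s2) (T (sl n) n ?D ?S 1 1)))"
      and v: "v = (((1 - a ^ k) / (1 - a)) ^ s1 * ((1 - a ^ (m - s1)) / (1 - a ^ m)) ^ (k - 1))
         \<cdot>\<^sub>m T (sl n) n ?D ?S m k"
      unfolding rels7_def by auto
    have ms: "m = Suc (s1 + s2)" "m - s1 = Suc s2" "m - 1 = s1 + s2"
      using s m by auto
    \<comment> \<open>The denominators in \<open>rels7\<close> do not vanish because
      \<open>m < n\<close>.\<close>
    have nz: "1 - a ^ m \<noteq> 0" "1 - a \<noteq> 0"
      using one_minus_a_power[of m] one_minus_a_power[of 1] m by auto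
    have "(a ^ k - 1) ^ s1 = ((1 - a ^ k) / (1 - a)) ^ s1 * (a - 1) ^ s1"
      using nz by (simp flip: power_mult_distrib add: field_simps)
    moreover have "(1 - a ^ Suc s2) ^ (k - 1)
        = ((1 - a ^ (m - s1)) / (1 - a ^ m)) ^ (k - 1) * (1 - a ^ m) ^ (k - 1)"
      unfolding ms(2) using nz by (simp flip: power_mult_distrib)
    ultimately have "(1 - a) * (a - 1) ^ s2 * (1 - a ^ Suc s2) ^ (k - 1) * (a ^ k - 1) ^ s1
      = ((1 - a ^ k) / (1 - a)) ^ s1 * ((1 - a ^ (m - s1)) / (1 - a ^ m)) ^ (k - 1)
        * ((1 - a) * (a - 1) ^ (m - 1) * (1 - a ^ m) ^ (k - 1))"
      unfolding ms(3) by (simp add: power_add)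
    moreover have "u = ((1 - a) * (a - 1) ^ s2 * (1 - a ^ Suc s2) ^ (k - 1) * (a ^ k - 1) ^ s1) \<cdot>\<^sub>m P k m"
      using n_ge_2 k unfolding u
      by (simp add: T_sl ad_shift_funpow ad_clock_funpow ms(1) add.commute del: sl_simps)
    moreover have "v = (((1 - a ^ k) / (1 - a)) ^ s1 * ((1 - a ^ (m - s1)) / (1 - a ^ m)) ^ (k - 1)
        * ((1 - a) * (a - 1) ^ (m - 1) * (1 - a ^ m) ^ (k - 1))) \<cdot>\<^sub>m P k m"
      unfolding v using m k by (subst T_sl) (auto simp: smult_smult_P simp del: sl_simps)
    ultimately show ?thesis
      by (simp only:)
  qed
qed

text \<open>The Fourier expansion without its \<open>(n, n)\<close> term, which is zero for matrices
  of trace zero.\<close>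

lemma P_span_sl:
  assumes N: "submodule class_ring N (sl n)"
    and P: "\<And>m k. (m, k) \<in> {1..n} \<times> {1..n} - {(n, n)} \<Longrightarrow> P k m \<in> N"
  shows "carrier (sl n) \<subseteq> N"
proof
  fix A assume A: "A \<in> carrier (sl n)"
  \<comment> \<open>Partial sums of the expansion, formed entrywise; adding one index at a time
    keeps them in \<open>N\<close>.\<close>
  define f where "f = (\<lambda>B. mat n n (\<lambda>ij. \<Sum>(m, k)\<in>B. coeff k m A * P k m $$ ij))"
  have "f B \<in> N" if "finite B" "B \<subseteq> {1..n} \<times> {1..n} - {(n, n)}" for B
    using that
  proof (induction B)
    case empty
    have "f {} = \<zero>\<^bsub>sl n\<^esub>"
      by (auto simp: f_def)
    then show ?case
      using submodule.zero_closed[OF N] by simp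
  next
    case (insert p B)
    obtain m k where p: "p = (m, k)"
      by (cases p)
    have "f (insert p B) = coeff k m A \<odot>\<^bsub>sl n\<^esub> P k m \<oplus>\<^bsub>sl n\<^esub> f B"
      using insert.hyps by (auto simp: f_def p)
    then show ?case
      using insert P[of m k] submodule.m_closed[OF N] submodule.smult_closed[OF N]
      by (simp add: p del: sl_simps)
  qed
  then have "f ({1..n} \<times> {1..n} - {(n, n)}) \<in> N"
    by simp
  moreover have "f ({1..n} \<times> {1..n} - {(n, n)}) = A"
  proof (rule eq_matI)
    fix i j assume "i < dim_row A" "j < dim_col A"
    then have ij: "i < n" "j < n"
      using A by auto
    have "A $$ (i, j) = (\<Sum>(m, k)\<in>{1..n} \<times> {1..n}. coeff k m A * P k m $$ (i, j))"
      using A ij by (intro mat_expansion) auto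
    also have "\<dots> = (\<Sum>(m, k)\<in>{1..n} \<times> {1..n} - {(n, n)}. coeff k m A * P k m $$ (i, j))"
      using n_ge_2 coeff_n_n[OF A] by (subst sum.remove[of _ "(n, n)"]) auto
    finally show "f ({1..n} \<times> {1..n} - {(n, n)}) $$ (i, j) = A $$ (i, j)"
      using ij by (simp add: f_def)
  qed (use A in \<open>auto simp: f_def\<close>)
  ultimately show "A \<in> N"
    by simp
qed

end

section \<open>The relations bound the dimension\<close>

lemma (in lie_algebra) ad_funpow_closed:
  "x \<in> carrier L \<Longrightarrow> y \<in> carrier L \<Longrightarrow> (ad L x ^^ j) y \<in> carrier L"
  by (induction j) (simp_all add: bracket_closed)

lemma T_less: "m \<noteq> n \<Longrightarrow> T L n D S m k = (ad L D ^^ (k - 1)) ((ad L S ^^ (m - 1)) (ad L D S))"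
  by (simp add: T_def)

lemma T_last: "n \<ge> 2 \<Longrightarrow> T L n D S n k = ad L S (T L n D S (n - 1) k)"
  by (auto simp: T_def)

lemma T_Suc: "m \<noteq> n \<Longrightarrow> k \<ge> 1 \<Longrightarrow> ad L D (T L n D S m k) = T L n D S m (Suc k)"
  by (cases k) (simp_all add: T_def)

text \<open>The index \<open>(m, k)\<close> belongs to \<open>D\<^sup>k S\<^sup>m\<close>, so \<open>D = D\<^sup>1 S\<^sup>n\<close> and \<open>S = D\<^sup>n S\<^sup>1\<close> fill two of the
  positions at which \<open>T\<^sub>m\<^sup>k\<close> is not listed.\<close>

definition clock_shift_elt ::
    "(complex, 'a, 'z) lie_alg_scheme \<Rightarrow> nat \<Rightarrow> 'a \<Rightarrow> 'a \<Rightarrow> nat \<times> nat \<Rightarrow> 'a" where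
  "clock_shift_elt L n D S p =
     (if p = (n, 1) then D else if p = (1, n) then S else T L n D S (fst p) (snd p))"

lemma image_Collect_case_prod:
  "(\<lambda>(x, y). f x y) ` {(x, y). Q x y} = {f x y | x y. Q x y}"
  by auto

text \<open>Removing the positions \<open>(n, 1)\<close> of \<open>D\<close> and
  \<open>(1, n)\<close> of \<open>S\<close> from the index set leaves exactly the pairs listed for
  \<open>T\<close>.\<close>

lemma image_clock_shift_elt:
  assumes "n \<ge> 2"
  shows "clock_shift_elt L n D S ` ({1..n} \<times> {1..n} - {(n, n)}) = {D, S} \<union>
    {T L n D S m k | m k. 1 \<le> k \<and> k \<le> n \<and> 1 \<le> m \<and> m \<le> n
       \<and> (m = 1 \<or> m = n \<longrightarrow> k \<noteq> n) \<and> (m = n \<longrightarrow> k \<noteq> 1)}"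
    (is "_ ` ?I = {D, S} \<union> {_ | m k. ?Q m k}")
proof -
  let ?J = "{(m, k). ?Q m k}"
  have mem: "(m, k) \<in> ?I \<longleftrightarrow> (m, k) \<in> {(n, 1), (1, n)} \<union> ?J" for m k
    unfolding Diff_iff mem_Sigma_iff atLeastAtMost_iff Un_iff insert_iff empty_iff prod.inject
      mem_Collect_eq prod.case
    using assms by presburger
  have "?I = {(n, 1), (1, n)} \<union> ?J"
    by (rule Set.set_eqI) (simp only: split_paired_all mem)
  moreover have elt: "clock_shift_elt L n D S (n, 1) = D" "clock_shift_elt L n D S (1, n) = S"
    using assms by (simp_all add: clock_shift_elt_def)
  moreover have "clock_shift_elt L n D S ` ?J = (\<lambda>(m, k). T L n D S m k) ` ?J"
  proof (rule image_cong[OF HOL.refl])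
    fix p assume p: "p \<in> ?J"
    obtain m k where mk: "p = (m, k)"
      by (cases p)
    have "(m, k) \<noteq> (n, 1)" "(m, k) \<noteq> (1, n)"
      using p unfolding mk mem_Collect_eq prod.case prod.inject by presburger+
    then show "clock_shift_elt L n D S p = (\<lambda>(m, k). T L n D S m k) p"
      by (simp only: clock_shift_elt_def mk if_False fst_conv snd_conv prod.case)
  qed
  moreover have "(\<lambda>(m, k). T L n D S m k) ` ?J = {T L n D S m k | m k. ?Q m k}"
    by (rule image_Collect_case_prod)
  ultimately show ?thesis
    by (simp only: image_Un image_insert image_empty)
qed

text \<open>The relations are imposed up to \<open>N\<close>, so that in the free Lie algebra
  \<open>N\<close> can be a submodule containing the ideal they generate.\<close>

lemma clock_shift_rels_ad_stable:
  fixes L :: "(complex, 'a, 'z) lie_alg_scheme" (structure)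
  assumes L: "lie_algebra class_ring L" and N: "submodule class_ring N L" and n: "n \<ge> 2"
    and elt: "clock_shift_elt L n D S ` ({1..n} \<times> {1..n} - {(n, n)}) \<subseteq> N"
    and rels: "\<And>u v. (u, v) \<in> clock_shift_rels L n a D S \<Longrightarrow> u \<ominus> v \<in> N"
    and p: "p \<in> {1..n} \<times> {1..n} - {(n, n)}"
  shows "ad L D (clock_shift_elt L n D S p) \<in> N" "ad L S (clock_shift_elt L n D S p) \<in> N"
proof -
  interpret lie_algebra class_ring L by fact
  have NL: "x \<in> carrier L" if "x \<in> N" for x
    using that submodule.subset[OF N] by blast
  have DS: "D \<in> N" "S \<in> N"
    using elt[unfolded image_clock_shift_elt[OF n]] by auto
  note closed = bracket_closed ad_funpow_closed NL[OF DS(1)] NL[OF DS(2)]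
  let ?T = "T L n D S"
  have T_closed: "?T m k \<in> carrier L" for m k
    by (simp add: T_def Let_def closed)
  have rel: "u \<in> N" if "(u, c \<odot> v) \<in> clock_shift_rels L n a D S" "u \<in> carrier L" "v \<in> N" for u c v
    using submodule_minusD[OF N rels[OF that(1)]] submodule.smult_closed[OF N] that by simp
  have rel0: "u \<in> N" if "(u, \<zero>) \<in> clock_shift_rels L n a D S" "u \<in> carrier L" for u
    using submodule_minusD[OF N rels[OF that(1)]] submodule.zero_closed[OF N] that by simp
  \<comment> \<open>The three unlisted elements: \<open>rels1\<close> makes \<open>?T 1 n\<close> a
    multiple of \<open>S\<close>, \<open>rels3\<close> makes \<open>?T n 1\<close> a multiple of
    \<open>D\<close>, and \<open>rels4\<close> makes \<open>?T n n\<close> zero, each up to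
    \<open>N\<close>.\<close>
  have "?T 1 n = (ad L D ^^ n) S"
    using n by (cases n) (simp_all add: T_def funpow_swap1)
  then have T1n: "?T 1 n \<in> N"
    using rel[of "(ad L D ^^ n) S" "(1 - a) ^ n" S] DS closed
    by (simp add: clock_shift_rels_def rels1_def)
  have "(?T n 1, ((1 - a) ^ n * (- 1) ^ (n - 1)) \<odot> D) \<in> clock_shift_rels L n a D S"
    unfolding T_last[OF n] clock_shift_rels_def rels3_def by blast
  then have Tn1: "?T n 1 \<in> N"
    using rel DS T_closed by blast
  have "(?T n n, \<zero>) \<in> clock_shift_rels L n a D S"
    unfolding T_last[OF n] clock_shift_rels_def rels4_def by blast
  then have Tnn: "?T n n \<in> N"
    using rel0 T_closed by blast
  have T: "?T m k \<in> N" if "1 \<le> m" "m \<le> n" "1 \<le> k" "k \<le> n" for m k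
  proof -
    consider "m = 1" "k = n" | "m = n" "k = n" | "m = n" "k = 1"
      | "m = 1 \<or> m = n \<longrightarrow> k \<noteq> n" "m = n \<longrightarrow> k \<noteq> 1"
      by argo
    then show ?thesis
    proof cases
      case 4
      show ?thesis
        by (rule subsetD[OF elt[unfolded image_clock_shift_elt[OF n]]], rule UnI2, rule CollectI,
            rule exI[of _ m], rule exI[of _ k]) (intro conjI HOL.refl that 4)
    qed (use T1n Tn1 Tnn in simp_all)
  qed
  \<comment> \<open>\<open>ad D\<close> raises \<open>k\<close> when \<open>m\<close> and
    \<open>k\<close> are below \<open>n\<close>; \<open>rels2\<close> treats \<open>k = n\<close>
    and \<open>rels6\<close> treats \<open>m = n\<close>.\<close>
  have adD: "ad L D (?T m k) \<in> N" if m: "1 \<le> m" "m \<le> n" and k: "1 \<le> k" "k \<le> n"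
    and mk: "m = n \<longrightarrow> 2 \<le> k \<and> k \<le> n - 1" for m k
  proof -
    consider "m = n" | "m < n" "k < n" | "m < n" "k = n"
      using m k by linarith
    then show ?thesis
    proof cases
      case 1
      then have "(ad L D (?T m k), \<zero>) \<in> clock_shift_rels L n a D S"
        using mk by (auto simp: clock_shift_rels_def rels6_def)
      then show ?thesis
        using rel0 T_closed closed by blast
    next
      case 2
      then show ?thesis
        using T_Suc[of m n k L D S] T[of m "Suc k"] m k by simp
    next
      case 3
      have "ad L D (?T m n) = (ad L D ^^ n) (?T m 1)"
        using 3 n by (cases n) (simp_all add: T_def)
      moreover have "((ad L D ^^ n) (?T m 1), (1 - a ^ m) ^ n \<odot> ?T m 1) \<in> clock_shift_rels L n a D S"
        using 3 m by (auto simp: clock_shift_rels_def rels2_def T_less)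
      ultimately show ?thesis
        using rel[of "(ad L D ^^ n) (?T m 1)" "(1 - a ^ m) ^ n" "?T m 1"] 3 T[of m 1] m n T_closed closed
        by simp
    qed
  qed
  \<comment> \<open>\<open>rels5\<close> treats \<open>m = n\<close>, the definition of
    \<open>T\<close> treats \<open>m = n - 1\<close>, and \<open>rels7\<close> the smaller
    \<open>m\<close>, except for \<open>(1, 2)\<close>.\<close>
  have adS: "ad L S (?T m k) \<in> N" if m: "1 \<le> m" "m \<le> n" and k: "1 \<le> k" "k \<le> n"
    and mk: "m = n \<longrightarrow> 2 \<le> k \<and> k \<le> n - 1" for m k
  proof -
    consider "m = n" | "m = n - 1" "m \<noteq> n" | "m < n - 1" "(m, k) = (1, 2)" | "m < n - 1" "(m, k) \<noteq> (1, 2)"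
      using m by linarith
    then show ?thesis
    proof cases
      case 1
      define c where "c = (- 1) ^ n * (1 - a ^ k)\<^sup>2 * (1 - a ^ (n - 1)) ^ (k - 1) * (1 - a) ^ (n - k - 1)"
      have "(ad L S (?T n k), c \<odot> ?T 1 k) \<in> clock_shift_rels L n a D S"
        using 1 mk by (auto simp: clock_shift_rels_def rels5_def c_def)
      then show ?thesis
        using rel[of "ad L S (?T n k)" c "?T 1 k"] 1 T[of 1 k] k n T_closed closed by simp
    next
      case 2
      then show ?thesis
        using T_last[OF n, of L D S k] T[of n k] k n by simp
    next
      case 3
      \<comment> \<open>\<open>rels7\<close> omits \<open>(2, 2)\<close>, and Jacobi replaces it:
        exchanging \<open>ad S\<close> and \<open>ad D\<close> on \<open>[D, S]\<close> costs
        \<open>[[S, D], [D, S]]\<close>, which is zero.\<close>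
      let ?X = "ad L D S"
      have X: "?X \<in> carrier L"
        using closed by blast
      have "ad L S (ad L D ?X) \<ominus> ad L D (ad L S ?X) = ad L (ad L S D) ?X"
        using X closed by (simp add: bracket_bracket_left)
      also have "\<dots> = \<zero>"
        using X closed by (simp add: bracket_antisym[of D S] bracket_uminus_left bracket_alternating)
      finally have "ad L S (ad L D ?X) = ad L D (ad L S ?X)"
        by (rule M.minus_eq_zeroD) (use X closed in auto)
      moreover have "?T 1 2 = ad L D ?X" "?T 2 2 = ad L D (ad L S ?X)"
        using 3 by (auto simp: T_def)
      ultimately show ?thesis
        using T[of 2 2] 3 by simp
    next
      case 4
      \<comment> \<open>The scalar of \<open>rels7\<close> at \<open>Suc m\<close> with
        \<open>s1 = 1\<close> and \<open>s2 = m - 1\<close>, describing a single step by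
        \<open>ad S\<close>.\<close>
      define c where "c = ((1 - a ^ k) / (1 - a)) ^ 1 * ((1 - a ^ (Suc m - 1)) / (1 - a ^ Suc m)) ^ (k - 1)"
      have "?T 1 1 = ad L D S"
        using n by (simp add: T_def)
      then have "ad L S (?T m k) = (ad L S ^^ 1) ((ad L D ^^ (k - 1)) ((ad L S ^^ (m - 1)) (?T 1 1)))"
        using 4 by (simp add: T_less)
      then have "(ad L S (?T m k), c \<odot> ?T (Suc m) k) \<in> rels7 L n a D S"
        unfolding rels7_def c_def using 4 m k
        by (intro CollectI exI[of _ "Suc m"] exI[of _ k] exI[of _ "1::nat"] exI[of _ "m - 1"]) auto
      then have "(ad L S (?T m k), c \<odot> ?T (Suc m) k) \<in> clock_shift_rels L n a D S"
        by (simp add: clock_shift_rels_def)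
      then show ?thesis
        using rel[of "ad L S (?T m k)" c "?T (Suc m) k"] 4 T[of "Suc m" k] m k T_closed closed by simp
    qed
  qed
  have T11: "ad L D S \<in> N"
    using T[of 1 1] n by (simp add: T_def)
  then have "ad L S D \<in> N"
    using bracket_antisym[of D S] submodule_uminus[OF N] closed by simp
  then have base: "ad L D D \<in> N" "ad L S D \<in> N" "ad L D S \<in> N" "ad L S S \<in> N"
    using T11 submodule.zero_closed[OF N] closed by (simp_all add: bracket_alternating)
  obtain m k where mk: "p = (m, k)"
    by (cases p)
  have "ad L D (clock_shift_elt L n D S p) \<in> N \<and> ad L S (clock_shift_elt L n D S p) \<in> N"
  proof (cases "p = (n, 1) \<or> p = (1, n)")
    case True
    then show ?thesis
      using base by (auto simp: clock_shift_elt_def)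
  next
    case False
    then have "clock_shift_elt L n D S p = ?T m k"
      by (simp only: clock_shift_elt_def mk de_Morgan_disj if_False fst_conv snd_conv)
    moreover have "1 \<le> m" "m \<le> n" "1 \<le> k" "k \<le> n" "m = n \<longrightarrow> 2 \<le> k \<and> k \<le> n - 1"
      using p False unfolding mk Diff_iff mem_Sigma_iff atLeastAtMost_iff insert_iff empty_iff
        prod.inject by presburger+
    ultimately show ?thesis
      using adD adS by simp
  qed
  then show "ad L D (clock_shift_elt L n D S p) \<in> N" "ad L S (clock_shift_elt L n D S p) \<in> N"
    by blast+
qed

text \<open>Brackets with generators preserve \<open>I\<close> because it is an ideal, and send the
  listed elements into the span by the relations; \<open>free_lie_ad_stable\<close>
  concludes.\<close>

lemma clock_shift_free_span:
  fixes I :: "(complex, gen) free_lie set"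
  defines "F \<equiv> free_lie_alg :: (complex, (complex, gen) free_lie) lie_alg"
    and "D \<equiv> free_gen GenD" and "S \<equiv> free_gen GenS"
  assumes I: "lie_ideal F I" and n: "n \<ge> 2"
    and rels: "\<And>u v. (u, v) \<in> clock_shift_rels F n a D S \<Longrightarrow> u \<ominus>\<^bsub>F\<^esub> v \<in> I"
  shows "LinearCombinations.module.span class_ring F
    (I \<union> clock_shift_elt F n D S ` ({1..n} \<times> {1..n} - {(n, n)})) = UNIV" (is "?N = UNIV")
proof -
  interpret F: lie_algebra class_ring F
    unfolding F_def by (rule lie_algebra_free_lie_alg)
  let ?X = "I \<union> clock_shift_elt F n D S ` ({1..n} \<times> {1..n} - {(n, n)})"
  have UNIV: "carrier F = UNIV"
    by (simp add: F_def)
  have N: "submodule class_ring ?N F"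
    by (rule F.span_is_submodule) (simp add: UNIV)
  have X: "?X \<subseteq> ?N"
    by (rule F.in_own_span) (simp add: UNIV)
  have ad: "ad F x y \<in> ?N" if "\<And>z. z \<in> ?X \<Longrightarrow> ad F x z \<in> ?N" "y \<in> ?N" for x y
  proof -
    \<comment> \<open>The preimage of a submodule under \<open>ad x\<close> is a submodule, so
      stability need only be tested on the spanning set.\<close>
    have "submodule class_ring {y. ad F x y \<in> ?N} F"
      using submodule.m_closed[OF N] submodule.zero_closed[OF N] submodule.smult_closed[OF N]
        F.module_axioms F.bracket_zero(1)[of x]
      by (auto simp: submodule_def UNIV F.bracket_add_right F.bracket_smult_right)
    then have "?N \<subseteq> {y. ad F x y \<in> ?N}"
      using that(1) by (intro F.span_is_subset) auto
    then show ?thesis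
      using that(2) by blast
  qed
  have elt: "ad F D (clock_shift_elt F n D S p) \<in> ?N \<and> ad F S (clock_shift_elt F n D S p) \<in> ?N"
    if "p \<in> {1..n} \<times> {1..n} - {(n, n)}" for p
    using clock_shift_rels_ad_stable[OF F.lie_algebra_axioms N n, of D S a p] X rels that by blast
  have gens: "D \<in> ?N" "S \<in> ?N"
    using X unfolding image_clock_shift_elt[OF n] by auto
  have "ad F (free_gen g) z \<in> ?N" if "z \<in> ?X" for g z
    using that
  proof
    assume "z \<in> I"
    then show ?thesis
      using I X by (auto simp: lie_ideal_def UNIV)
  next
    assume "z \<in> clock_shift_elt F n D S ` ({1..n} \<times> {1..n} - {(n, n)})"
    then show ?thesis
      using elt by (cases g) (auto simp: D_def S_def)
  qed
  then have stable: "ad F (free_gen g) y \<in> ?N" if "y \<in> ?N" for g y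
    using ad that by blast
  show ?thesis
  proof (rule free_lie_ad_stable)
    show "submodule class_ring ?N (free_lie_alg :: (complex, (complex, gen) free_lie) lie_alg)"
      using N by (simp add: F_def)
    show "free_gen g \<in> ?N" for g
      using gens by (cases g) (auto simp: D_def S_def)
    show "free_bracket (free_gen g) x \<in> ?N" if "x \<in> ?N" for g x
      using stable[OF that, of g] by (simp add: F_def)
  qed
qed

text \<open>A substitute for counting dimensions. The map \<open>\<psi>\<close> projects onto the
  span of the \<open>b p\<close>; those \<open>x\<close> with \<open>x - \<psi> x\<close> in
  \<open>I\<close> form a submodule containing \<open>I\<close> and every \<open>b p\<close>, hence
  are all of \<open>M\<close>. If all \<open>\<mu> p x\<close> vanish, then \<open>\<psi> x\<close>
  is zero and \<open>x\<close> lies in \<open>I\<close>.\<close>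

lemma (in Module.module) mem_submodule_if_dual_vanishes:
  assumes I: "submodule R I M" and B: "finite B" and b: "b \<in> B \<rightarrow> carrier M"
    and span: "span (I \<union> b ` B) = carrier M"
    and closed: "\<And>p x. p \<in> B \<Longrightarrow> x \<in> carrier M \<Longrightarrow> \<mu> p x \<in> carrier R"
    and add: "\<And>p x y. p \<in> B \<Longrightarrow> x \<in> carrier M \<Longrightarrow> y \<in> carrier M
      \<Longrightarrow> \<mu> p (x \<oplus>\<^bsub>M\<^esub> y) = \<mu> p x \<oplus>\<^bsub>R\<^esub> \<mu> p y"
    and smult: "\<And>p c x. p \<in> B \<Longrightarrow> c \<in> carrier R \<Longrightarrow> x \<in> carrier M
      \<Longrightarrow> \<mu> p (c \<odot>\<^bsub>M\<^esub> x) = c \<otimes>\<^bsub>R\<^esub> \<mu> p x"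
    and \<mu>_I: "\<And>p x. p \<in> B \<Longrightarrow> x \<in> I \<Longrightarrow> \<mu> p x = \<zero>\<^bsub>R\<^esub>"
    and dual: "\<And>p q. p \<in> B \<Longrightarrow> q \<in> B \<Longrightarrow> \<mu> p (b q) = (if p = q then \<one>\<^bsub>R\<^esub> else \<zero>\<^bsub>R\<^esub>)"
    and x: "x \<in> carrier M" and vanish: "\<And>p. p \<in> B \<Longrightarrow> \<mu> p x = \<zero>\<^bsub>R\<^esub>"
  shows "x \<in> I"
proof -
  define \<psi> where "\<psi> = (\<lambda>x. \<Oplus>\<^bsub>M\<^esub>p\<in>B. \<mu> p x \<odot>\<^bsub>M\<^esub> b p)"
  have term_closed: "(\<lambda>p. \<mu> p x \<odot>\<^bsub>M\<^esub> b p) \<in> B \<rightarrow> carrier M" if "x \<in> carrier M" for x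
    using that b closed by auto
  have \<psi>_closed: "\<psi> x \<in> carrier M" if "x \<in> carrier M" for x
    unfolding \<psi>_def using term_closed[OF that] by (rule M.finsum_closed)
  have \<psi>_zero: "\<psi> x = \<zero>\<^bsub>M\<^esub>" if "\<And>p. p \<in> B \<Longrightarrow> \<mu> p x = \<zero>\<^bsub>R\<^esub>" for x
    unfolding \<psi>_def using that b by (intro M.add.finprod_one_eqI) (auto simp: Pi_iff)
  have \<psi>_add: "\<psi> (x \<oplus>\<^bsub>M\<^esub> y) = \<psi> x \<oplus>\<^bsub>M\<^esub> \<psi> y" if "x \<in> carrier M" "y \<in> carrier M" for x y
  proof -
    have "\<psi> (x \<oplus>\<^bsub>M\<^esub> y) = (\<Oplus>\<^bsub>M\<^esub>p\<in>B. \<mu> p x \<odot>\<^bsub>M\<^esub> b p \<oplus>\<^bsub>M\<^esub> \<mu> p y \<odot>\<^bsub>M\<^esub> b p)"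
      unfolding \<psi>_def using that b closed
      by (intro M.finsum_cong') (auto simp: add smult_l_distr Pi_iff)
    also have "\<dots> = \<psi> x \<oplus>\<^bsub>M\<^esub> \<psi> y"
      unfolding \<psi>_def using term_closed that by (intro M.finsum_addf) auto
    finally show ?thesis .
  qed
  have \<psi>_smult: "\<psi> (c \<odot>\<^bsub>M\<^esub> x) = c \<odot>\<^bsub>M\<^esub> \<psi> x" if "c \<in> carrier R" "x \<in> carrier M" for c x
  proof -
    have "\<psi> (c \<odot>\<^bsub>M\<^esub> x) = (\<Oplus>\<^bsub>M\<^esub>p\<in>B. c \<odot>\<^bsub>M\<^esub> (\<mu> p x \<odot>\<^bsub>M\<^esub> b p))"
      unfolding \<psi>_def using that b closed
      by (intro M.finsum_cong') (auto simp: smult smult_assoc1 Pi_iff)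
    also have "\<dots> = c \<odot>\<^bsub>M\<^esub> \<psi> x"
      unfolding \<psi>_def using finsum_smult[OF that(1) term_closed[OF that(2)]] by simp
    finally show ?thesis .
  qed
  have \<psi>_b: "\<psi> (b q) = b q" if "q \<in> B" for q
  proof -
    have "\<psi> (b q) = (\<Oplus>\<^bsub>M\<^esub>p\<in>B. if q = p then b p else \<zero>\<^bsub>M\<^esub>)"
      unfolding \<psi>_def using that b by (intro M.finsum_cong') (auto simp: dual Pi_iff)
    also have "\<dots> = b q"
      using that B b by (intro M.finsum_singleton) auto
    finally show ?thesis .
  qed
  define N where "N = {x \<in> carrier M. x \<ominus>\<^bsub>M\<^esub> \<psi> x \<in> I}"
  have "submodule R N M"
  proof (rule submodule.intro)
    show "Module.module R M" ..
    show "N \<subseteq> carrier M"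
      by (auto simp: N_def)
    show "x \<oplus>\<^bsub>M\<^esub> y \<in> N" if "x \<in> N" "y \<in> N" for x y
    proof -
      have xy: "x \<in> carrier M" "y \<in> carrier M"
        using that by (auto simp: N_def)
      then have "(x \<oplus>\<^bsub>M\<^esub> y) \<ominus>\<^bsub>M\<^esub> \<psi> (x \<oplus>\<^bsub>M\<^esub> y) = (x \<ominus>\<^bsub>M\<^esub> \<psi> x) \<oplus>\<^bsub>M\<^esub> (y \<ominus>\<^bsub>M\<^esub> \<psi> y)"
        using \<psi>_closed by (simp add: \<psi>_add a_minus_def M.minus_add M.a_ac)
      then show ?thesis
        using that xy submodule.m_closed[OF I] by (simp add: N_def)
    qed
    show "\<zero>\<^bsub>M\<^esub> \<in> N"
      using submodule_minus[OF I] submodule.zero_closed[OF I] \<psi>_zero[of "\<zero>\<^bsub>M\<^esub>"] \<mu>_I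
      by (simp add: N_def)
    show "c \<odot>\<^bsub>M\<^esub> x \<in> N" if "c \<in> carrier R" "x \<in> N" for c x
    proof -
      have x: "x \<in> carrier M"
        using that by (auto simp: N_def)
      then have "(c \<odot>\<^bsub>M\<^esub> x) \<ominus>\<^bsub>M\<^esub> \<psi> (c \<odot>\<^bsub>M\<^esub> x) = c \<odot>\<^bsub>M\<^esub> (x \<ominus>\<^bsub>M\<^esub> \<psi> x)"
        using that(1) \<psi>_closed by (simp add: \<psi>_smult a_minus_def smult_r_distr smult_r_minus)
      then show ?thesis
        using that x submodule.smult_closed[OF I] by (simp add: N_def)
    qed
  qed
  moreover have "x \<in> N" if "x \<in> I" for x
    using that submodule.subset[OF I] submodule_minus[OF I that submodule.zero_closed[OF I]]
      \<psi>_zero[of x] \<mu>_I by (auto simp: N_def)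
  moreover have "b q \<in> N" if "q \<in> B" for q
    using that b submodule.zero_closed[OF I] by (auto simp: N_def \<psi>_b a_minus_def M.r_neg Pi_iff)
  ultimately have "x \<in> N"
    using span_is_subset[of "I \<union> b ` B" N] x unfolding span by blast
  then show ?thesis
    using submodule_minusD[OF I _ submodule.zero_closed[OF I] x] \<psi>_zero[OF vanish]
    by (simp add: N_def)
qed

section \<open>The presentation\<close>

lemma lie_subalgebra_T:
  assumes H: "lie_subalgebra L H" and D: "D \<in> H" and S: "S \<in> H"
  shows "T L n D S m k \<in> H"
proof -
  have br: "bracket L x y \<in> H" if "x \<in> H" "y \<in> H" for x y
    using H that by (simp add: lie_subalgebra_def)
  have "(ad L x ^^ j) y \<in> H" if "x \<in> H" "y \<in> H" for x y j
    using that by (induction j) (simp_all add: br)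
  then show ?thesis
    using D S br by (simp add: T_def Let_def)
qed

lemma lie_hom_T:
  assumes L: "lie_algebra class_ring L" and f: "f \<in> lie_hom L M"
    and D: "D \<in> carrier L" and S: "S \<in> carrier L"
  shows "f (T L n D S m k) = T M n (f D) (f S) m k"
proof -
  interpret lie_algebra class_ring L by fact
  have br: "f (bracket L x y) = bracket M (f x) (f y)" if "x \<in> carrier L" "y \<in> carrier L" for x y
    using f that by (simp add: lie_hom_def)
  have "f ((ad L x ^^ j) y) = (ad M (f x) ^^ j) (f y)"
    if "x \<in> carrier L" "y \<in> carrier L" for x y j
    using that by (induction j) (simp_all add: br ad_funpow_closed)
  then show ?thesis
    using D S by (simp add: T_def Let_def br ad_funpow_closed bracket_closed)
qed

text \<open>Each relation is the same bracket expression in every Lie algebra, so relations in the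
  free Lie algebra can be checked on matrices.\<close>

lemma lie_hom_clock_shift_rels:
  fixes L :: "(complex, 'a, 'y) lie_alg_scheme" and M :: "(complex, 'b, 'z) lie_alg_scheme"
  assumes L: "lie_algebra class_ring L" and M: "lie_algebra class_ring M" and f: "f \<in> lie_hom L M"
    and D: "D \<in> carrier L" and S: "S \<in> carrier L"
    and uv: "(u, v) \<in> clock_shift_rels L n a D S"
  shows "(f u, f v) \<in> clock_shift_rels M n a (f D) (f S)"
proof -
  interpret L: lie_algebra class_ring L by fact
  interpret M: lie_algebra class_ring M by fact
  interpret f: mod_hom class_ring L M f
    using f by unfold_locales (auto simp: lie_hom_def)
  have br: "f (bracket L x y) = bracket M (f x) (f y)" if "x \<in> carrier L" "y \<in> carrier L" for x y
    using f that by (simp add: lie_hom_def)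
  have pow: "f ((ad L x ^^ j) y) = (ad M (f x) ^^ j) (f y)"
    if "x \<in> carrier L" "y \<in> carrier L" for x y j
    using that by (induction j) (simp_all add: br L.ad_funpow_closed)
  have smult: "f (c \<odot>\<^bsub>L\<^esub> x) = c \<odot>\<^bsub>M\<^esub> f x" if "x \<in> carrier L" for c x
    using f.f_smult[of c x] that by simp
  note fT = lie_hom_T[OF L f D S]
  have T_closed: "T L n D S m k \<in> carrier L" for m k
    using D S by (simp add: T_def Let_def L.bracket_closed L.ad_funpow_closed)
  note closed = L.bracket_closed L.ad_funpow_closed T_closed D S
  have smult_closed: "c \<odot>\<^bsub>L\<^esub> x \<in> carrier L" if "x \<in> carrier L" for c x
    using that by simp
  note simps = br pow smult fT closed smult_closed f.f0_is_0
  consider "(u, v) \<in> rels1 L n a D S" | "(u, v) \<in> rels2 L n a D S"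
    | "(u, v) \<in> rels3 L n a D S" | "(u, v) \<in> rels4 L n D S"
    | "(u, v) \<in> rels5 L n a D S" | "(u, v) \<in> rels6 L n D S"
    | "(u, v) \<in> rels7 L n a D S"
    using uv unfolding clock_shift_rels_def by blast
  then show ?thesis
  proof cases
    case 1
    then have u: "u = (ad L D ^^ n) S" and v: "v = (1 - a) ^ n \<odot>\<^bsub>L\<^esub> S"
      unfolding rels1_def by simp_all
    have "f u = (ad M (f D) ^^ n) (f S)" "f v = (1 - a) ^ n \<odot>\<^bsub>M\<^esub> f S"
      unfolding u v by (simp_all only: simps)
    then show ?thesis
      unfolding clock_shift_rels_def rels1_def by simp
  next
    case 2
    then obtain m where m: "1 \<le> m" "m \<le> n - 1"
      and u: "u = (ad L D ^^ n) ((ad L S ^^ (m - 1)) (ad L D S))"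
      and v: "v = (1 - a ^ m) ^ n \<odot>\<^bsub>L\<^esub> (ad L S ^^ (m - 1)) (ad L D S)"
      unfolding rels2_def by blast
    have "f u = (ad M (f D) ^^ n) ((ad M (f S) ^^ (m - 1)) (ad M (f D) (f S)))"
      "f v = (1 - a ^ m) ^ n \<odot>\<^bsub>M\<^esub> (ad M (f S) ^^ (m - 1)) (ad M (f D) (f S))"
      unfolding u v by (simp_all only: simps)
    then show ?thesis
      using m unfolding clock_shift_rels_def rels2_def by blast
  next
    case 3
    then have u: "u = ad L S (T L n D S (n - 1) 1)"
      and v: "v = ((1 - a) ^ n * (- 1) ^ (n - 1)) \<odot>\<^bsub>L\<^esub> D"
      unfolding rels3_def by simp_all
    have "f u = ad M (f S) (T M n (f D) (f S) (n - 1) 1)"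
      "f v = ((1 - a) ^ n * (- 1) ^ (n - 1)) \<odot>\<^bsub>M\<^esub> f D"
      unfolding u v by (simp_all only: simps)
    then show ?thesis
      unfolding clock_shift_rels_def rels3_def by simp
  next
    case 4
    then have u: "u = ad L S (T L n D S (n - 1) n)" and v: "v = \<zero>\<^bsub>L\<^esub>"
      unfolding rels4_def by simp_all
    have "f u = ad M (f S) (T M n (f D) (f S) (n - 1) n)" "f v = \<zero>\<^bsub>M\<^esub>"
      unfolding u v by (simp_all only: simps)
    then show ?thesis
      unfolding clock_shift_rels_def rels4_def by simp
  next
    case 5
    define c where "c k = (- 1) ^ n * (1 - a ^ k)\<^sup>2 * (1 - a ^ (n - 1)) ^ (k - 1) * (1 - a) ^ (n - k - 1)" for k
    obtain k where k: "2 \<le> k" "k \<le> n - 1"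
      and u: "u = ad L S (T L n D S n k)" and v: "v = c k \<odot>\<^bsub>L\<^esub> T L n D S 1 k"
      using 5 unfolding rels5_def c_def by blast
    have "f u = ad M (f S) (T M n (f D) (f S) n k)" "f v = c k \<odot>\<^bsub>M\<^esub> T M n (f D) (f S) 1 k"
      unfolding u v by (simp_all only: simps)
    then show ?thesis
      using k unfolding clock_shift_rels_def rels5_def c_def by blast
  next
    case 6
    then obtain k where k: "2 \<le> k" "k \<le> n - 1"
      and u: "u = ad L D (T L n D S n k)" and v: "v = \<zero>\<^bsub>L\<^esub>"
      unfolding rels6_def by blast
    have "f u = ad M (f D) (T M n (f D) (f S) n k)" "f v = \<zero>\<^bsub>M\<^esub>"
      unfolding u v by (simp_all only: simps)
    then show ?thesis
      using k unfolding clock_shift_rels_def rels6_def by blast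
  next
    case 7
    define c where "c m k s1 = ((1 - a ^ k) / (1 - a)) ^ s1 * ((1 - a ^ (m - s1)) / (1 - a ^ m)) ^ (k - 1)"
      for m k s1 :: nat
    obtain m k s1 s2 where m: "2 \<le> m \<and> m \<le> n - 1 \<and> 1 \<le> k \<and> k \<le> n \<and> (m, k) \<noteq> (2, 2)
        \<and> 1 \<le> s1 \<and> s1 \<le> m - 1 \<and> s1 + s2 = m - 1"
      and u: "u = (ad L S ^^ s1) ((ad L D ^^ (k - 1)) ((ad L S ^^ s2) (T L n D S 1 1)))"
      and v: "v = c m k s1 \<odot>\<^bsub>L\<^esub> T L n D S m k"
      using 7 unfolding rels7_def c_def by blast
    have fuv: "f u = (ad M (f S) ^^ s1) ((ad M (f D) ^^ (k - 1)) ((ad M (f S) ^^ s2) (T M n (f D) (f S) 1 1)))"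
      "f v = c m k s1 \<odot>\<^bsub>M\<^esub> T M n (f D) (f S) m k"
      unfolding u v by (simp_all only: simps)
    have "(f u, f v) \<in> rels7 M n a (f D) (f S)"
      unfolding rels7_def fuv c_def
      by (rule CollectI, rule exI[of _ m], rule exI[of _ k], rule exI[of _ s1], rule exI[of _ s2])
        (rule conjI[OF HOL.refl m])
    then show ?thesis
      unfolding clock_shift_rels_def by blast
  qed
qed

lemma lie_hom_clock_shift_elt:
  assumes "lie_algebra class_ring L" "f \<in> lie_hom L M" "D \<in> carrier L" "S \<in> carrier L"
  shows "f (clock_shift_elt L n D S p) = clock_shift_elt M n (f D) (f S) p"
  unfolding clock_shift_elt_def if_distrib[of f] lie_hom_T[OF assms] ..

lemma lie_subalgebra_clock_shift_elt:
  assumes "lie_subalgebra L H" "D \<in> H" "S \<in> H"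
  shows "clock_shift_elt L n D S p \<in> H"
  unfolding clock_shift_elt_def using assms lie_subalgebra_T[OF assms] by simp

lemma lie_subalgebra_carrier:
  assumes "lie_algebra class_ring L"
  shows "lie_subalgebra L (carrier L)"
proof -
  interpret lie_algebra class_ring L by fact
  show ?thesis
    using module_axioms by (auto simp: lie_subalgebra_def submodule_def bracket_closed)
qed

section \<open>The isomorphism with \<open>sl n\<close>\<close>

context primitive_root
begin

text \<open>By periodicity \<open>D\<close> is \<open>P 1 n\<close> and \<open>S\<close> is
  \<open>P n 1\<close>. The scalars of the \<open>T\<close> are nonzero because they involve only
  \<open>1 - a ^ j\<close> with \<open>0 < j < n\<close>, up to sign.\<close>

lemma clock_shift_elt_sl:
  assumes "p \<in> {1..n} \<times> {1..n} - {(n, n)}"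
  shows "\<exists>c. c \<noteq> 0 \<and>
    clock_shift_elt (sl n) n (clock n a) (shift n) p = c \<cdot>\<^sub>m P (snd p) (fst p)"
proof -
  let ?D = "clock n a" and ?S = "shift n"
  obtain m k where p: "p = (m, k)" and mk: "1 \<le> m" "m \<le> n" "1 \<le> k" "k \<le> n" "\<not> (m = n \<and> k = n)"
    using assms by (cases p) auto
  note nz = one_minus_a_power
  have a1: "1 - a \<noteq> 0" "a - 1 \<noteq> 0"
    using nz[of 1] n_ge_2 by auto
  consider "p = (n, 1)" | "p = (1, n)" | "p \<noteq> (n, 1)" "p \<noteq> (1, n)" "m = n"
    | "p \<noteq> (n, 1)" "p \<noteq> (1, n)" "m \<noteq> n"
    by blast
  then show ?thesis
  proof cases
    case 1
    have "clock_shift_elt (sl n) n ?D ?S p = 1 \<cdot>\<^sub>m P 1 n"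
      unfolding clock_shift_elt_def 1 by (simp add: one_smult_P clock_eq_clock_shift_mat)
    then show ?thesis
      using 1 by (intro exI[of _ 1]) simp
  next
    case 2
    have "clock_shift_elt (sl n) n ?D ?S p = 1 \<cdot>\<^sub>m P n 1"
      unfolding clock_shift_elt_def 2 using n_ge_2
      by (simp add: one_smult_P shift_eq_clock_shift_mat[of n a])
    then show ?thesis
      using 2 by (intro exI[of _ 1]) simp
  next
    case 3
    define c where "c = (1 - a) * (a - 1) ^ (n - 2) * (1 - a ^ (n - 1)) ^ (k - 1) * (a ^ k - 1)"
    have "clock_shift_elt (sl n) n ?D ?S p = T (sl n) n ?D ?S n k"
      by (simp only: clock_shift_elt_def 3(1,2) if_False) (simp only: p 3(3) fst_conv snd_conv)
    also have "\<dots> = c \<cdot>\<^sub>m P k n"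
      unfolding c_def T_sl_n[OF mk(3)] by simp
    finally have "clock_shift_elt (sl n) n ?D ?S p = c \<cdot>\<^sub>m P (snd p) (fst p)"
      by (simp only: p 3(3) fst_conv snd_conv)
    moreover have "a ^ k - 1 \<noteq> 0"
      using nz[of k] mk 3(3) by (cases "k = n") auto
    then have "c \<noteq> 0"
      using a1 nz[of "n - 1"] n_ge_2 by (simp add: c_def)
    ultimately show ?thesis
      by blast
  next
    case 4
    define c where "c = (1 - a) * (a - 1) ^ (m - 1) * (1 - a ^ m) ^ (k - 1)"
    have "m < n"
      using 4(3) mk by simp
    have "clock_shift_elt (sl n) n ?D ?S p = T (sl n) n ?D ?S m k"
      by (simp only: clock_shift_elt_def 4(1,2) if_False) (simp only: p fst_conv snd_conv)
    also have "\<dots> = c \<cdot>\<^sub>m P k m"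
      unfolding c_def by (rule T_sl) (use mk \<open>m < n\<close> in auto)
    finally have "clock_shift_elt (sl n) n ?D ?S p = c \<cdot>\<^sub>m P (snd p) (fst p)"
      by (simp only: p fst_conv snd_conv)
    moreover have "c \<noteq> 0"
      using a1 nz[of m] mk \<open>m < n\<close> by (simp add: c_def)
    ultimately show ?thesis
      by blast
  qed
qed

lemma clock_shift_elt_span_sl:
  assumes N: "submodule class_ring N (sl n)"
    and elt: "\<And>p. p \<in> {1..n} \<times> {1..n} - {(n, n)}
      \<Longrightarrow> clock_shift_elt (sl n) n (clock n a) (shift n) p \<in> N"
  shows "carrier (sl n) \<subseteq> N"
proof (rule P_span_sl[OF N])
  fix m k assume mk: "(m, k) \<in> {1..n} \<times> {1..n} - {(n, n)}"
  from clock_shift_elt_sl[OF this] obtain c where c: "c \<noteq> 0"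
    "clock_shift_elt (sl n) n (clock n a) (shift n) (m, k) = c \<cdot>\<^sub>m P k m"
    by auto
  have "inverse c \<odot>\<^bsub>sl n\<^esub> clock_shift_elt (sl n) n (clock n a) (shift n) (m, k) \<in> N"
    using elt[OF mk] by (intro submodule.smult_closed[OF N]) auto
  then show "P k m \<in> N"
    using c by (simp add: smult_smult_P one_smult_P)
qed

lemma clock_sl: "clock n a \<in> carrier (sl n)"
  unfolding clock_eq_clock_shift_mat by (rule P_sl) (use n_ge_2 in auto)

lemma shift_sl: "shift n \<in> carrier (sl n)"
  unfolding shift_eq_clock_shift_mat[of n a] by (rule P_sl) (use n_ge_2 in auto)

lemma lie_presentation_sl:
  "lie_presentation (sl n) (case_gen (clock n a) (shift n))
    (clock_shift_rels free_lie_alg n a (free_gen GenD) (free_gen GenS))"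
proof -
  let ?F = "free_lie_alg :: (complex, (complex, gen) free_lie) lie_alg"
  let ?B = "{1..n} \<times> {1..n} - {(n, n)}"
  let ?d = "free_gen GenD" and ?s = "free_gen GenS" and ?D = "clock n a" and ?S = "shift n"
  let ?R = "clock_shift_rels ?F n a ?d ?s"
  define I where "I = lie_ideal ?F hull {u \<ominus>\<^bsub>?F\<^esub> v | u v. (u, v) \<in> ?R}"
  interpret F: lie_algebra class_ring ?F by (rule lie_algebra_free_lie_alg)
  interpret sl: lie_algebra class_ring "sl n" by (rule lie_algebra_sl)
  have "case_gen ?D ?S x \<in> carrier (sl n)" for x
    using clock_sl shift_sl by (cases x) simp_all
  from ex1_implies_ex[OF free_lie_alg_universal[OF lie_algebra_sl this]]
  obtain \<phi> where "\<phi> \<in> lie_hom ?F (sl n) \<and> (\<forall>x. \<phi> (free_gen x) = case_gen ?D ?S x)"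
    by (rule exE)
  then have \<phi>: "\<phi> \<in> lie_hom ?F (sl n)" and \<phi>_gen: "\<phi> (free_gen x) = case_gen ?D ?S x" for x
    by (rule conjunct1, elim conjE allE)
  interpret \<phi>: mod_hom class_ring ?F "sl n" \<phi>
    using \<phi> by unfold_locales (auto simp: lie_hom_def)
  have \<phi>_closed: "\<phi> x \<in> carrier (sl n)" for x
    by (rule \<phi>.f_im) simp
  have \<phi>_DS: "\<phi> ?d = ?D" "\<phi> ?s = ?S"
    by (simp_all add: \<phi>_gen)
  have \<phi>_elt: "\<phi> (clock_shift_elt ?F n ?d ?s p) = clock_shift_elt (sl n) n ?D ?S p" for p
    using lie_hom_clock_shift_elt[OF lie_algebra_free_lie_alg \<phi>, of ?d ?s n p] by (simp only: \<phi>_DS free_lie_alg_simps UNIV_I)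
  have I: "lie_ideal ?F I"
    unfolding I_def by (rule lie_ideal_hull)
  have I_sub: "submodule class_ring I ?F"
    using I by (simp add: lie_ideal_def)
  have rel_I: "u \<ominus>\<^bsub>?F\<^esub> v \<in> I" if "(u, v) \<in> ?R" for u v
    unfolding I_def by (rule hull_inc) (use that in blast)
  \<comment> \<open>The kernel is an ideal containing all differences of relations, so it contains
    the smallest such ideal \<open>I\<close>.\<close>
  have I_ker: "\<phi> x = \<zero>\<^bsub>sl n\<^esub>" if "x \<in> I" for x
  proof -
    have "I \<subseteq> {x \<in> carrier ?F. \<phi> x = \<zero>\<^bsub>sl n\<^esub>}"
      unfolding I_def
    proof (rule hull_minimal)
      show "lie_ideal ?F {x \<in> carrier ?F. \<phi> x = \<zero>\<^bsub>sl n\<^esub>}"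
        by (rule lie_ideal_kernel[OF lie_algebra_free_lie_alg lie_algebra_sl \<phi>])
      show "{u \<ominus>\<^bsub>?F\<^esub> v | u v. (u, v) \<in> ?R} \<subseteq> {x \<in> carrier ?F. \<phi> x = \<zero>\<^bsub>sl n\<^esub>}"
      proof clarify
        fix u v assume uv: "(u, v) \<in> ?R"
        have "(\<phi> u, \<phi> v) \<in> clock_shift_rels (sl n) n a (\<phi> ?d) (\<phi> ?s)"
          by (rule lie_hom_clock_shift_rels[OF lie_algebra_free_lie_alg lie_algebra_sl \<phi> _ _ uv])
            simp_all
        then have "\<phi> u = \<phi> v"
          unfolding \<phi>_DS by (rule clock_shift_rels_sl)
        moreover have "\<phi> (u \<ominus>\<^bsub>?F\<^esub> v) = \<phi> u \<ominus>\<^bsub>sl n\<^esub> \<phi> v"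
          by (rule \<phi>.f_minus) simp_all
        ultimately have "\<phi> (u \<ominus>\<^bsub>?F\<^esub> v) = \<zero>\<^bsub>sl n\<^esub>"
          using \<phi>_closed[of v] by (simp only: a_minus_def sl.M.r_neg)
        then show "u \<ominus>\<^bsub>?F\<^esub> v \<in> carrier ?F \<and> \<phi> (u \<ominus>\<^bsub>?F\<^esub> v) = \<zero>\<^bsub>sl n\<^esub>"
          by (simp only: free_lie_alg_simps UNIV_I simp_thms)
      qed
    qed
    then show ?thesis
      using that by blast
  qed
  have "\<exists>c. \<forall>p\<in>?B. c p \<noteq> 0 \<and>
      clock_shift_elt (sl n) n ?D ?S p = c p \<cdot>\<^sub>m P (snd p) (fst p)"
    by (rule bchoice, rule ballI, rule clock_shift_elt_sl)
  then obtain c where c': "\<forall>p\<in>?B. c p \<noteq> 0 \<and>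
      clock_shift_elt (sl n) n ?D ?S p = c p \<cdot>\<^sub>m P (snd p) (fst p)"
    by (rule exE)
  note c = bspec[OF c']
  \<comment> \<open>The dual functionals are the Fourier coefficients of \<open>\<phi> x\<close>,
    divided by \<open>c p\<close> so that they equal 1 on the matching element.\<close>
  have ker_I: "x \<in> I" if x: "\<phi> x = \<zero>\<^bsub>sl n\<^esub>" for x
  proof (rule F.mem_submodule_if_dual_vanishes[OF I_sub, where B = ?B
        and b = "clock_shift_elt ?F n ?d ?s"
        and \<mu> = "\<lambda>p x. coeff (snd p) (fst p) (\<phi> x) / c p"])
    show "F.span (I \<union> clock_shift_elt ?F n ?d ?s ` ?B) = carrier ?F"
      using clock_shift_free_span[OF I n_ge_2 rel_I] by (simp only: free_lie_alg_simps)
    show "coeff (snd p) (fst p) (\<phi> (x \<oplus>\<^bsub>?F\<^esub> y)) / c p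
        = coeff (snd p) (fst p) (\<phi> x) / c p \<oplus>\<^bsub>class_ring\<^esub> coeff (snd p) (fst p) (\<phi> y) / c p" for p x y
    proof -
      have "\<phi> (x \<oplus>\<^bsub>?F\<^esub> y) = \<phi> x + \<phi> y"
        using \<phi>.f_add[of x y] by simp
      then show ?thesis
        using \<phi>_closed[of x] \<phi>_closed[of y]
        by (simp add: clock_shift_coeff_add add_divide_distrib)
    qed
    show "coeff (snd p) (fst p) (\<phi> (r \<odot>\<^bsub>?F\<^esub> x)) / c p
        = r \<otimes>\<^bsub>class_ring\<^esub> (coeff (snd p) (fst p) (\<phi> x) / c p)" for p r x
    proof -
      have "\<phi> (r \<odot>\<^bsub>?F\<^esub> x) = r \<cdot>\<^sub>m \<phi> x"
        using \<phi>.f_smult[of r x] by simp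
      then show ?thesis
        using \<phi>_closed[of x] by (simp add: clock_shift_coeff_smult)
    qed
    have zero: "coeff k m (\<zero>\<^bsub>sl n\<^esub>) = 0" for k m
      by (simp add: clock_shift_coeff_def)
    show "coeff (snd p) (fst p) (\<phi> x) / c p = \<zero>\<^bsub>class_ring\<^esub>" if "x \<in> I" for p x
      unfolding I_ker[OF that] zero by simp
    show "coeff (snd p) (fst p) (\<phi> x) / c p = \<zero>\<^bsub>class_ring\<^esub>" for p
      unfolding x zero by simp
    show "coeff (snd p) (fst p) (\<phi> (clock_shift_elt ?F n ?d ?s q)) / c p
        = (if p = q then \<one>\<^bsub>class_ring\<^esub> else \<zero>\<^bsub>class_ring\<^esub>)" if "p \<in> ?B" "q \<in> ?B" for p q
    proof -
      have "coeff (snd p) (fst p) (clock_shift_elt (sl n) n ?D ?S q)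
          = c q * coeff (snd p) (fst p) (P (snd q) (fst q))"
        using c[OF that(2)] by (simp add: clock_shift_coeff_smult[OF clock_shift_mat_carrier(1)])
      also have "\<dots> = c q * (if p = q then 1 else 0)"
        using that by (subst coeff_P) (auto simp: prod_eq_iff)
      finally show ?thesis
        unfolding \<phi>_elt using c[OF that(1)] by auto
    qed
  qed auto
  have onto: "range \<phi> = carrier (sl n)"
  proof
    have "submodule class_ring (range \<phi>) (sl n)"
      using \<phi>.im_is_submodule by (simp add: \<phi>.im_def)
    then show "carrier (sl n) \<subseteq> range \<phi>"
      by (rule clock_shift_elt_span_sl) (metis \<phi>_elt rangeI)
  qed (use \<phi>_closed in blast)
  show ?thesis
    by (rule lie_presentationI[OF lie_algebra_sl \<phi> \<phi>_gen onto])
      (use I_ker ker_I in \<open>unfold I_def, blast\<close>)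
qed

end

theorem theorem1p1:
  fixes n :: nat and a :: complex and D S :: "complex mat"
  assumes "n \<ge> 2"
    and "a = exp (2 * complex_of_real pi * \<i> / of_nat n)"
    and "D = clock n a"
    and "S = shift n"
  shows "lie_subalgebra (sl n) hull {D, S} = carrier (sl n)
    \<and> carrier (sl n) =
           LinearCombinations.module.span class_ring (sl n)
             ({D, S} \<union>
              {T (sl n) n D S m k | m k.
                 1 \<le> k \<and> k \<le> n \<and> 1 \<le> m \<and> m \<le> n
                   \<and> (m = 1 \<or> m = n \<longrightarrow> k \<noteq> n) \<and> (m = n \<longrightarrow> k \<noteq> 1)})
    \<and> lie_presentation (sl n) (case_gen D S)
           (clock_shift_rels free_lie_alg n a (free_gen GenD) (free_gen GenS))"
proof -
  interpret primitive_root n a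
    unfolding assms(2) by (rule primitive_root_exp[OF assms(1)])
  interpret sl: lie_algebra class_ring "sl n" by (rule lie_algebra_sl)
  let ?B = "{1..n} \<times> {1..n} - {(n, n)}"
  \<comment> \<open>The spanning set of the statement, kept in indexed form until
    \<open>image_clock_shift_elt\<close> translates it at the end.\<close>
  let ?E = "clock_shift_elt (sl n) n D S ` ?B"
  have DS: "{D, S} \<subseteq> carrier (sl n)"
    using clock_sl shift_sl unfolding assms(3,4) by blast
  have sub: "lie_subalgebra (sl n) (carrier (sl n))"
    by (rule lie_subalgebra_carrier[OF lie_algebra_sl])
  have hull: "lie_subalgebra (sl n) hull {D, S} = carrier (sl n)"
  proof (rule hull_unique)
    show "{D, S} \<subseteq> carrier (sl n)" "lie_subalgebra (sl n) (carrier (sl n))"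
      by (fact DS, fact sub)
  next
    \<comment> \<open>A subalgebra containing \<open>D\<close> and \<open>S\<close> contains all
      iterated brackets \<open>T\<close>, and together these span \<open>sl n\<close>.\<close>
    fix H assume H: "{D, S} \<subseteq> H" "lie_subalgebra (sl n) H"
    show "carrier (sl n) \<subseteq> H"
    proof (rule clock_shift_elt_span_sl)
      show "submodule class_ring H (sl n)"
        using H(2) by (simp add: lie_subalgebra_def)
      show "clock_shift_elt (sl n) n (clock n a) (shift n) p \<in> H" for p
        using lie_subalgebra_clock_shift_elt[OF H(2)] H(1) unfolding assms(3,4) by blast
    qed
  qed
  have E: "?E \<subseteq> carrier (sl n)"
    using lie_subalgebra_clock_shift_elt[OF sub] DS by blast
  have "carrier (sl n) = sl.span ?E"
  proof
    show "carrier (sl n) \<subseteq> sl.span ?E"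
      using sl.in_own_span[OF E] unfolding assms(3,4)
      by (intro clock_shift_elt_span_sl sl.span_is_submodule) (use E[unfolded assms(3,4)] in blast)+
  qed (rule sl.span_is_subset2[OF E])
  then show ?thesis
    using hull lie_presentation_sl unfolding image_clock_shift_elt[OF assms(1)] assms(3,4)
    by blast
qed

end
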